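(* Let $q\in\mathbb{R}\setminus\{0\}$, let $\alpha,\beta\in\mathbb{R}$, and take $\gamma=q^2$, $\epsilon=q^{-4}$ in the definition of $\delta$ on 2-forms of the quantum sphere $S^2_q$; let $\Delta=\delta\,\mathrm{d}+\mathrm{d}\,\delta$ and $x=bc$. The following is the list of eigen-1-forms of $\Delta$ on $\Omega^1S^2_q$ with their eigenvalues (i.e. each is an eigenvector with the stated eigenvalue, and together they form a basis of $\Omega^1S^2_q$): (1) for $n\ge1$, $p\ge0$: $e^+a^nb^{n+2}\sum_{r=0}^p q^{(p-r)^2}{p\brack r}{2n+p+r+2\brack n+r+2}x^r$, eigenvalue $(\beta+\alpha q^{-2})[n+p+2][n+p+1]q^{1-2n-2p}$; (2) for $n\ge2$, $p\ge0$: $e^-a^nb^{n-2}\sum_{r=0}^p q^{(p-r)^2}{p\brack r}{2n+p+r-2\brack n+r-2}x^r$, eigenvalue $(\beta+\alpha q^{-2})[n+p][n+p-1]q^{5-2n-2p}$; (3) for $n\ge2$, $m\ge0$: $e^+d^nc^{n-2}\sum_{r=0}^m q^{(m-r)(2n+m-r)}{m\brack r}{2n+m+r-2\brack n+r-2}x^r$, eigenvalue $(\beta+\alpha q^{-2})[n+m][n+m-1]q^{5-2n-2m}$; (4) for $n\ge1$, $m\ge0$: $e^-d^nc^{n+2}\sum_{r=0}^m q^{(m-r)(2n+m-r)}{m\brack r}{2n+m+r+2\brack n+r+2}x^r$, eigenvalue $(\beta+\alpha q^{-2})[m+n+2][m+n+1]q^{1-2m-2n}$; (5) for $p\ge0$: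 $e^+b^2\sum_{r=0}^p q^{(p-r)^2}{p\brack r}{p+r+2\brack r+2}x^r$, eigenvalue $(\beta+\alpha q^{-2})[p+2][p+1]q^{1-2p}$; (6) for $m\ge0$: $e^-c^2\sum_{r=0}^m q^{(m-r)^2}{m\brack r}{m+r+2\brack r+2}x^r$, eigenvalue $(\beta+\alpha q^{-2})[m+2][m+1]q^{1-2m}$; (7) for $p\ge0$: $e^+d\,b\sum_{r=0}^p q^{(p-r)(2+p-r)}{p\brack r}{p+r+2\brack r+1}x^r$, eigenvalue $(\beta+\alpha q^{-2})[p+2][p+1]q^{1-2p}$; (8) for $m\ge0$: $e^-a\,c\sum_{r=0}^m q^{(m-r)^2}{m\brack r}{m+r+2\brack r+1}x^r$, eigenvalue $(\beta+\alpha q^{-2})[m+2][m+1]q^{1-2m}$.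
   Context: $\mathbb{C}_q[SL_2]$ is the unital associative $\mathbb{C}$-algebra with generators $a,b,c,d$ and relations $ba=qab$, $ca=qac$, $db=qbd$, $dc=qcd$, $cb=bc$, $da-ad=q(1-q^{-2})bc$, $ad-q^{-1}bc=1$. It is $\mathbb{Z}$-graded with $a,c$ of grade $+1$ and $b,d$ of grade $-1$; $S^2_q$ is the grade-zero subalgebra. (The differential is written $\mathrm{d}$, distinct from the generator $d$.) Adjoin $e^\pm$ of grade $\pm2$ with $e^\pm f=q^{g}fe^\pm$ for $f\in\mathbb{C}_q[SL_2]$ homogeneous of grade $g$, and $q^2e^+\wedge e^-+e^-\wedge e^+=0$, $e^\pm\wedge e^\pm=0$; the $a^nb^mc^p$, $d^nb^mc^p$ $(n\ge1)$ and $b^mc^p$ form a basis of $\mathbb{C}_q[SL_2]$, over which $e^\pm$ and $e^+\wedge e^-$ are free. $\Omega^1S^2_q$ is the set of $e^+f_++e^-f_-$ with $f_\pm$ of grade $\mp2$, $\Omega^2S^2_q$ the set of $f\,e^+\wedge e^-$ with $f\in S^2_q$. $\mathrm{d}$ is the derivation with $\mathrm{d}a=q\,b\,e^+$, $\mathrm{d}b=a\,e^-$, $\mathrm{d}c=q\,d\,e^+$, $\mathrm{d}d=c\,e^-$, extended to forms by the graded Leibniz rule with $\mathrm{d}e^\pm=0$. Write $\mathrm{d}f=e^+\partial_+f+e^-\partial_-f$. The homotopy $\delta$ comes from the metric $\alpha(v^+\otimes v^-)+\beta(v^-\otimes v^+)$ ($v^\pm$ dual to $e^\pm$), the left connection with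 $\nabla e^\pm=0$, and interior product $v^+\lrcorner(e^+\wedge e^-)=\gamma e^-$, $v^-\lrcorner(e^+\wedge e^-)=-\epsilon e^+$; explicitly $\delta f=0$ on $S^2_q$, $\delta(e^+f_++e^-f_-)=\alpha q^{-2}\partial_-f_++\beta q^2\partial_+f_-$, and $\delta(f\,e^+\wedge e^-)=\alpha\gamma q^{-4}e^-\partial_-f-\beta\epsilon q^4e^+\partial_+f$. $[n]=1+q^2+\dots+q^{2(n-1)}$, $[0]=0$, $[n]!=[n]\cdots[1]$, ${p\brack r}=\frac{[p]!}{[r]![p-r]!}$. *)

theory Defs
  imports
    "HOL-Algebra.QuotRing"
    "HOL-Algebra.Module"
    "HOL-Library.Poly_Mapping"
    Complex_Main
begin

section \<open>The free algebra on \<open>a, b, c, d, e\<^sup>+, e\<^sup>-\<close>\<close>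

datatype gen = Ga | Gb | Gc | Gd | Gep | Gem

text \<open>Words are a copy of \<^typ>\<open>gen list\<close>, made an (additively written) monoid under concatenation,
  so that the convolution product of \<^typ>\<open>'a \<Rightarrow>\<^sub>0 'b\<close> turns \<open>word \<Rightarrow>\<^sub>0 complex\<close> into the free
  unital associative complex algebra.\<close>

datatype word = Word (letters: "gen list")

instantiation word :: monoid_add
begin
definition zero_word :: word where "0 = Word []"
definition plus_word :: "word \<Rightarrow> word \<Rightarrow> word" where "u + v = Word (letters u @ letters v)"
instance by standard (auto simp: zero_word_def plus_word_def)
end

type_synonym free = "word \<Rightarrow>\<^sub>0 complex"

definition var :: "gen \<Rightarrow> free" where
  "var g = Poly_Mapping.single (Word [g]) 1"

definition const :: "complex \<Rightarrow> free" where
  "const z = Poly_Mapping.single 0 z"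

fun gen_grade :: "gen \<Rightarrow> int" where
  "gen_grade Ga = 1" | "gen_grade Gc = 1"
| "gen_grade Gb = -1" | "gen_grade Gd = -1"
| "gen_grade Gep = 2" | "gen_grade Gem = -2"

definition word_grade :: "word \<Rightarrow> int" where
  "word_grade w = (\<Sum>g\<leftarrow>letters w. gen_grade g)"

definition word_deg :: "word \<Rightarrow> nat" where
  "word_deg w = length (filter (\<lambda>g. g \<in> {Gep, Gem}) (letters w))"

definition free_ring :: "free ring" where
  "free_ring = \<lparr>carrier = UNIV, mult = (*), one = 1, zero = 0, add = (+)\<rparr>"


section \<open>Quantum integers and binomials (in \<open>q\<^sup>2\<close>)\<close>

definition qint :: "real \<Rightarrow> nat \<Rightarrow> real" where
  "qint q n = (\<Sum>i<n. q ^ (2 * i))"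

definition qfact :: "real \<Rightarrow> nat \<Rightarrow> real" where
  "qfact q n = (\<Prod>i=1..n. qint q i)"

definition qbinom :: "real \<Rightarrow> nat \<Rightarrow> nat \<Rightarrow> real" where
  "qbinom q p r = qfact q p / (qfact q r * qfact q (p - r))"


section \<open>Bases of a subspace\<close>

text \<open>\<open>V\<close> is meant to be a linear subspace, as \<open>\<Omega>\<^sup>1 S\<^sup>2\<^sub>q\<close> is; finite combinations of the family then stay in \<open>V\<close>.\<close>

definition is_basis ::
  "(complex, 'v, 'm) module_scheme \<Rightarrow> 'v set \<Rightarrow> 'i set \<Rightarrow> ('i \<Rightarrow> 'v) \<Rightarrow> bool" where
  "is_basis M V I v \<longleftrightarrow> v ` I \<subseteq> V \<and>
     (\<forall>x\<in>V. \<exists>!c. finite {i. c i \<noteq> 0} \<and> {i. c i \<noteq> 0} \<subseteq> I \<and>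
        x = (\<Oplus>\<^bsub>M\<^esub>i\<in>{i. c i \<noteq> 0}. c i \<odot>\<^bsub>M\<^esub> v i))"


section \<open>Forms on the quantum group and the quantum sphere\<close>

context
  fixes q :: real
begin

text \<open>The first seven relations present \<open>\<complex>\<^sub>q[SL\<^sub>2]\<close>; the others adjoin \<open>e\<^sup>+\<close> and \<open>e\<^sup>-\<close>.  Setting
  \<open>e\<^sup>+ = e\<^sup>- = 0\<close> is compatible with all of them, which gives a retraction of the algebra \<open>Hq\<close> presented
  here onto the algebra presented by the first seven alone.  So the latter is the subalgebra of \<open>Hq\<close>
  generated by \<open>a, b, c, d\<close>, and it is taken in this form below (\<open>CqSL2\<close>).\<close>

definition relations :: "free set" where
  "relations =
     { var Gb * var Ga - const q * var Ga * var Gb,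
       var Gc * var Ga - const q * var Ga * var Gc,
       var Gd * var Gb - const q * var Gb * var Gd,
       var Gd * var Gc - const q * var Gc * var Gd,
       var Gc * var Gb - var Gb * var Gc,
       var Gd * var Ga - var Ga * var Gd - const (q * (1 - q powi (-2))) * var Gb * var Gc,
       var Ga * var Gd - const (q powi (-1)) * var Gb * var Gc - 1 } \<union>
     { var e * f - const (q powi g) * f * var e | e f g.
         e \<in> {Gep, Gem} \<and> (\<forall>w\<in>Poly_Mapping.keys f. word_deg w = 0 \<and> word_grade w = g) } \<union>
     { const (q\<^sup>2) * var Gep * var Gem + var Gem * var Gep,
       var Gep * var Gep,
       var Gem * var Gem }"

abbreviation rel_ideal :: "free set" where
  "rel_ideal \<equiv> Idl\<^bsub>free_ring\<^esub> relations"

definition cl :: "free \<Rightarrow> free set" where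
  "cl u = rel_ideal +>\<^bsub>free_ring\<^esub> u"

definition Hq :: "(complex, free set) module" where
  "Hq = (let Q = free_ring Quot rel_ideal in
     \<lparr>carrier = carrier Q, mult = mult Q, one = one Q, zero = zero Q, add = add Q,
      smult = (\<lambda>z x. cl (const z) \<otimes>\<^bsub>Q\<^esub> x)\<rparr>)"

abbreviation "el_a \<equiv> cl (var Ga)"
abbreviation "el_b \<equiv> cl (var Gb)"
abbreviation "el_c \<equiv> cl (var Gc)"
abbreviation "el_d \<equiv> cl (var Gd)"
abbreviation "el_ep \<equiv> cl (var Gep)"
abbreviation "el_em \<equiv> cl (var Gem)"

definition forms :: "nat \<Rightarrow> free set set" where
  "forms k = cl ` {u. \<forall>w\<in>Poly_Mapping.keys u. word_deg w = k}"

abbreviation CqSL2 :: "free set set" where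
  "CqSL2 \<equiv> forms 0"

definition CqSL2_grade :: "int \<Rightarrow> free set set" where
  "CqSL2_grade g = cl ` {u. \<forall>w\<in>Poly_Mapping.keys u. word_deg w = 0 \<and> word_grade w = g}"

abbreviation S2 :: "free set set" where
  "S2 \<equiv> CqSL2_grade 0"

definition Omega1_S2 :: "free set set" where
  "Omega1_S2 = {el_ep \<otimes>\<^bsub>Hq\<^esub> fp \<oplus>\<^bsub>Hq\<^esub> el_em \<otimes>\<^bsub>Hq\<^esub> fm | fp fm.
     fp \<in> CqSL2_grade (-2) \<and> fm \<in> CqSL2_grade 2}"

definition Omega2_S2 :: "free set set" where
  "Omega2_S2 = {f \<otimes>\<^bsub>Hq\<^esub> (el_ep \<otimes>\<^bsub>Hq\<^esub> el_em) | f. f \<in> S2}"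

definition is_differential :: "(free set \<Rightarrow> free set) \<Rightarrow> bool" where
  "is_differential D \<longleftrightarrow>
     D \<in> carrier Hq \<rightarrow> carrier Hq \<and>
     (\<forall>x\<in>carrier Hq. \<forall>y\<in>carrier Hq. D (x \<oplus>\<^bsub>Hq\<^esub> y) = D x \<oplus>\<^bsub>Hq\<^esub> D y) \<and>
     (\<forall>z. \<forall>x\<in>carrier Hq. D (z \<odot>\<^bsub>Hq\<^esub> x) = z \<odot>\<^bsub>Hq\<^esub> D x) \<and>
     (\<forall>k. \<forall>x\<in>forms k. \<forall>y\<in>carrier Hq.
        D (x \<otimes>\<^bsub>Hq\<^esub> y) = D x \<otimes>\<^bsub>Hq\<^esub> y \<oplus>\<^bsub>Hq\<^esub> (-1) ^ k \<odot>\<^bsub>Hq\<^esub> (x \<otimes>\<^bsub>Hq\<^esub> D y)) \<and>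
     D el_a = q \<odot>\<^bsub>Hq\<^esub> (el_b \<otimes>\<^bsub>Hq\<^esub> el_ep) \<and>
     D el_b = el_a \<otimes>\<^bsub>Hq\<^esub> el_em \<and>
     D el_c = q \<odot>\<^bsub>Hq\<^esub> (el_d \<otimes>\<^bsub>Hq\<^esub> el_ep) \<and>
     D el_d = el_c \<otimes>\<^bsub>Hq\<^esub> el_em \<and>
     D el_ep = \<zero>\<^bsub>Hq\<^esub> \<and>
     D el_em = \<zero>\<^bsub>Hq\<^esub>"

text \<open>The conditions determine the map on \<open>carrier Hq\<close>; only its arbitrary values elsewhere are chosen.\<close>

definition ext_d :: "free set \<Rightarrow> free set" where
  "ext_d = (SOME D. is_differential D)"

text \<open>Coefficients of \<open>e\<^sup>+ f\<^sub>+ + e\<^sup>- f\<^sub>-\<close> and of \<open>f e\<^sup>+ \<and> e\<^sup>-\<close>, unique because these forms are free over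
  \<open>\<complex>\<^sub>q[SL\<^sub>2]\<close>.\<close>

definition coeff_p :: "free set \<Rightarrow> free set" where
  "coeff_p \<omega> = (THE fp. fp \<in> CqSL2 \<and>
     (\<exists>fm\<in>CqSL2. \<omega> = el_ep \<otimes>\<^bsub>Hq\<^esub> fp \<oplus>\<^bsub>Hq\<^esub> el_em \<otimes>\<^bsub>Hq\<^esub> fm))"

definition coeff_m :: "free set \<Rightarrow> free set" where
  "coeff_m \<omega> = (THE fm. fm \<in> CqSL2 \<and>
     (\<exists>fp\<in>CqSL2. \<omega> = el_ep \<otimes>\<^bsub>Hq\<^esub> fp \<oplus>\<^bsub>Hq\<^esub> el_em \<otimes>\<^bsub>Hq\<^esub> fm))"

definition coeff_top :: "free set \<Rightarrow> free set" where
  "coeff_top \<omega> = (THE f. f \<in> CqSL2 \<and> \<omega> = f \<otimes>\<^bsub>Hq\<^esub> (el_ep \<otimes>\<^bsub>Hq\<^esub> el_em))"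

definition del_p :: "free set \<Rightarrow> free set" where
  "del_p f = coeff_p (ext_d f)"

definition del_m :: "free set \<Rightarrow> free set" where
  "del_m f = coeff_m (ext_d f)"

text \<open>\<open>codiff \<alpha> \<beta> \<gamma> \<epsilon> k\<close> is \<open>\<delta>\<close> on \<open>\<Omega>\<^sup>k S\<^sup>2\<^sub>q\<close>; its values outside that space are irrelevant.\<close>

definition codiff :: "real \<Rightarrow> real \<Rightarrow> real \<Rightarrow> real \<Rightarrow> nat \<Rightarrow> free set \<Rightarrow> free set" where
  "codiff \<alpha> \<beta> \<gamma> \<epsilon> k \<omega> =
     (if k = 1 then
        complex_of_real (\<alpha> * q powi (-2)) \<odot>\<^bsub>Hq\<^esub> del_m (coeff_p \<omega>)
        \<oplus>\<^bsub>Hq\<^esub> complex_of_real (\<beta> * q\<^sup>2) \<odot>\<^bsub>Hq\<^esub> del_p (coeff_m \<omega>)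
      else if k = 2 then
        complex_of_real (\<alpha> * \<gamma> * q powi (-4)) \<odot>\<^bsub>Hq\<^esub> (el_em \<otimes>\<^bsub>Hq\<^esub> del_m (coeff_top \<omega>))
        \<ominus>\<^bsub>Hq\<^esub> complex_of_real (\<beta> * \<epsilon> * q ^ 4) \<odot>\<^bsub>Hq\<^esub> (el_ep \<otimes>\<^bsub>Hq\<^esub> del_p (coeff_top \<omega>))
      else \<zero>\<^bsub>Hq\<^esub>)"

definition Laplacian :: "real \<Rightarrow> real \<Rightarrow> real \<Rightarrow> real \<Rightarrow> nat \<Rightarrow> free set \<Rightarrow> free set" where
  "Laplacian \<alpha> \<beta> \<gamma> \<epsilon> k \<omega> =
     codiff \<alpha> \<beta> \<gamma> \<epsilon> (Suc k) (ext_d \<omega>) \<oplus>\<^bsub>Hq\<^esub> ext_d (codiff \<alpha> \<beta> \<gamma> \<epsilon> k \<omega>)"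


section \<open>The list of eigenforms\<close>

definition xpoly :: "nat \<Rightarrow> (nat \<Rightarrow> real) \<Rightarrow> free set" where
  "xpoly p s = (\<Oplus>\<^bsub>Hq\<^esub>r\<in>{..p}. complex_of_real (s r) \<odot>\<^bsub>Hq\<^esub> (el_b \<otimes>\<^bsub>Hq\<^esub> el_c) [^]\<^bsub>Hq\<^esub> r)"

end

datatype eig_index =
  Eig1 nat nat | Eig2 nat nat | Eig3 nat nat | Eig4 nat nat | Eig5 nat | Eig6 nat | Eig7 nat | Eig8 nat

fun in_list :: "eig_index \<Rightarrow> bool" where
  "in_list (Eig1 n p) \<longleftrightarrow> n \<ge> 1"
| "in_list (Eig2 n p) \<longleftrightarrow> n \<ge> 2"
| "in_list (Eig3 n m) \<longleftrightarrow> n \<ge> 2"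
| "in_list (Eig4 n m) \<longleftrightarrow> n \<ge> 1"
| "in_list (Eig5 p) \<longleftrightarrow> True"
| "in_list (Eig6 m) \<longleftrightarrow> True"
| "in_list (Eig7 p) \<longleftrightarrow> True"
| "in_list (Eig8 m) \<longleftrightarrow> True"

fun eigenform :: "real \<Rightarrow> eig_index \<Rightarrow> free set" where
  "eigenform q (Eig1 n p) =
     el_ep q \<otimes>\<^bsub>Hq q\<^esub> el_a q [^]\<^bsub>Hq q\<^esub> n \<otimes>\<^bsub>Hq q\<^esub> el_b q [^]\<^bsub>Hq q\<^esub> (n + 2) \<otimes>\<^bsub>Hq q\<^esub>
       xpoly q p (\<lambda>r. q ^ ((p - r)\<^sup>2) * qbinom q p r * qbinom q (2*n + p + r + 2) (n + r + 2))"
| "eigenform q (Eig2 n p) =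
     el_em q \<otimes>\<^bsub>Hq q\<^esub> el_a q [^]\<^bsub>Hq q\<^esub> n \<otimes>\<^bsub>Hq q\<^esub> el_b q [^]\<^bsub>Hq q\<^esub> (n - 2) \<otimes>\<^bsub>Hq q\<^esub>
       xpoly q p (\<lambda>r. q ^ ((p - r)\<^sup>2) * qbinom q p r * qbinom q (2*n + p + r - 2) (n + r - 2))"
| "eigenform q (Eig3 n m) =
     el_ep q \<otimes>\<^bsub>Hq q\<^esub> el_d q [^]\<^bsub>Hq q\<^esub> n \<otimes>\<^bsub>Hq q\<^esub> el_c q [^]\<^bsub>Hq q\<^esub> (n - 2) \<otimes>\<^bsub>Hq q\<^esub>
       xpoly q m (\<lambda>r. q ^ ((m - r) * (2*n + m - r)) * qbinom q m r
                        * qbinom q (2*n + m + r - 2) (n + r - 2))"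
| "eigenform q (Eig4 n m) =
     el_em q \<otimes>\<^bsub>Hq q\<^esub> el_d q [^]\<^bsub>Hq q\<^esub> n \<otimes>\<^bsub>Hq q\<^esub> el_c q [^]\<^bsub>Hq q\<^esub> (n + 2) \<otimes>\<^bsub>Hq q\<^esub>
       xpoly q m (\<lambda>r. q ^ ((m - r) * (2*n + m - r)) * qbinom q m r
                        * qbinom q (2*n + m + r + 2) (n + r + 2))"
| "eigenform q (Eig5 p) =
     el_ep q \<otimes>\<^bsub>Hq q\<^esub> el_b q [^]\<^bsub>Hq q\<^esub> (2::nat) \<otimes>\<^bsub>Hq q\<^esub>
       xpoly q p (\<lambda>r. q ^ ((p - r)\<^sup>2) * qbinom q p r * qbinom q (p + r + 2) (r + 2))"
| "eigenform q (Eig6 m) =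
     el_em q \<otimes>\<^bsub>Hq q\<^esub> el_c q [^]\<^bsub>Hq q\<^esub> (2::nat) \<otimes>\<^bsub>Hq q\<^esub>
       xpoly q m (\<lambda>r. q ^ ((m - r)\<^sup>2) * qbinom q m r * qbinom q (m + r + 2) (r + 2))"
| "eigenform q (Eig7 p) =
     el_ep q \<otimes>\<^bsub>Hq q\<^esub> el_d q \<otimes>\<^bsub>Hq q\<^esub> el_b q \<otimes>\<^bsub>Hq q\<^esub>
       xpoly q p (\<lambda>r. q ^ ((p - r) * (2 + p - r)) * qbinom q p r * qbinom q (p + r + 2) (r + 1))"
| "eigenform q (Eig8 m) =
     el_em q \<otimes>\<^bsub>Hq q\<^esub> el_a q \<otimes>\<^bsub>Hq q\<^esub> el_c q \<otimes>\<^bsub>Hq q\<^esub>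
       xpoly q m (\<lambda>r. q ^ ((m - r)\<^sup>2) * qbinom q m r * qbinom q (m + r + 2) (r + 1))"

fun eigenvalue :: "real \<Rightarrow> real \<Rightarrow> real \<Rightarrow> eig_index \<Rightarrow> real" where
  "eigenvalue q \<alpha> \<beta> (Eig1 n p) = (\<beta> + \<alpha> * q powi (-2)) *
     qint q (n + p + 2) * qint q (n + p + 1) * q powi (1 - 2 * int n - 2 * int p)"
| "eigenvalue q \<alpha> \<beta> (Eig2 n p) = (\<beta> + \<alpha> * q powi (-2)) *
     qint q (n + p) * qint q (n + p - 1) * q powi (5 - 2 * int n - 2 * int p)"
| "eigenvalue q \<alpha> \<beta> (Eig3 n m) = (\<beta> + \<alpha> * q powi (-2)) *
     qint q (n + m) * qint q (n + m - 1) * q powi (5 - 2 * int n - 2 * int m)"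
| "eigenvalue q \<alpha> \<beta> (Eig4 n m) = (\<beta> + \<alpha> * q powi (-2)) *
     qint q (m + n + 2) * qint q (m + n + 1) * q powi (1 - 2 * int m - 2 * int n)"
| "eigenvalue q \<alpha> \<beta> (Eig5 p) = (\<beta> + \<alpha> * q powi (-2)) *
     qint q (p + 2) * qint q (p + 1) * q powi (1 - 2 * int p)"
| "eigenvalue q \<alpha> \<beta> (Eig6 m) = (\<beta> + \<alpha> * q powi (-2)) *
     qint q (m + 2) * qint q (m + 1) * q powi (1 - 2 * int m)"
| "eigenvalue q \<alpha> \<beta> (Eig7 p) = (\<beta> + \<alpha> * q powi (-2)) *
     qint q (p + 2) * qint q (p + 1) * q powi (1 - 2 * int p)"
| "eigenvalue q \<alpha> \<beta> (Eig8 m) = (\<beta> + \<alpha> * q powi (-2)) *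
     qint q (m + 2) * qint q (m + 1) * q powi (1 - 2 * int m)"

end

theory Submission
  imports Defs "HOL-Library.Product_Plus"
begin

text \<open>
  The relations, the differential and the Laplacian all live on a quotient of a free algebra, where
  nothing can be read off directly.  The argument therefore replaces that quotient by coordinates.

  On the space \<open>A\<close> with basis \<open>(k, m, p)\<close>, standing for \<open>a\<^sup>k b\<^sup>m c\<^sup>p\<close> if \<open>k \<ge> 0\<close> and for
  \<open>d\<^sup>-\<^sup>k b\<^sup>m c\<^sup>p\<close> if \<open>k < 0\<close>, the left multiplications by \<open>a, b, c, d\<close> and the partial derivatives
  \<open>\<partial>\<^sub>+, \<partial>\<^sub>-\<close> have explicit formulas.  The space of forms is \<open>A\<^sup>4\<close>, a quadruple being the coefficients of
  \<open>1, e\<^sup>+, e\<^sup>-, e\<^sup>+ e\<^sup>-\<close>.  The free algebra acts on it, the relations act as zero (\<open>rho_relations\<close>), and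
  conversely the relations suffice to rewrite every element into normal form (\<open>congr_nf_rho\<close>).
  Evaluating at the vector \<open>1\<close> thus gives a linear isomorphism between \<open>A\<^sup>4\<close> and the quotient
  algebra; this contains the PBW theorem and the freeness of the forms.  The operator that \<open>\<partial>\<^sub>+\<close> and
  \<open>\<partial>\<^sub>-\<close> induce on \<open>A\<^sup>4\<close> satisfies the graded Leibniz rule, so the differential exists; a differential
  is determined by its values on the generators, so it is this one (\<open>ext_d_form\<close>).

  For the given \<open>\<gamma>, \<epsilon>\<close> the cross terms of the Laplacian cancel:
  \<open>\<Delta> (e\<^sup>+ f + e\<^sup>- g) = (\<beta> + \<alpha> q\<^sup>-\<^sup>2) (e\<^sup>+ \<partial>\<^sub>+ \<partial>\<^sub>- f + q\<^sup>2 e\<^sup>- \<partial>\<^sub>- \<partial>\<^sub>+ g)\<close>.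
  The maps \<open>\<partial>\<^sub>+ \<partial>\<^sub>-\<close> and \<open>q\<^sup>2 \<partial>\<^sub>- \<partial>\<^sub>+\<close> preserve \<open>k\<close> and the difference of the exponents of \<open>b\<close> and \<open>c\<close>, and
  send \<open>x\<^sup>r\<close> to a combination of \<open>x\<^sup>r\<close> and \<open>x\<^sup>r\<^sup>-\<^sup>1\<close> times the same monomial.  The eigenvector
  equation is hence a two-term recurrence for the coefficients, and a single \<open>q\<close>-binomial identity
  (\<open>spin_coeff_recurrence\<close>) solves it in all eight families at once.  Finally, the leading terms of the eigenforms run exactly
  once through the basis monomials of the right grade, so the family is triangular with respect to
  the monomial basis and is itself a basis (\<open>triangular_basis\<close>).
\<close>

abbreviation (input) "single \<equiv> Poly_Mapping.single"
abbreviation (input) "lookup \<equiv> Poly_Mapping.lookup"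

section \<open>Complex vector spaces and linear extension\<close>

class scaleC =
  fixes scaleC :: "complex \<Rightarrow> 'a \<Rightarrow> 'a" (infixr "*\<^sub>C" 75)

class cvec = scaleC + ab_group_add +
  assumes scaleC_add_right: "z *\<^sub>C (x + y) = z *\<^sub>C x + z *\<^sub>C y"
    and scaleC_add_left: "(w + z) *\<^sub>C x = w *\<^sub>C x + z *\<^sub>C x"
    and scaleC_scaleC [simp]: "w *\<^sub>C z *\<^sub>C x = (w * z) *\<^sub>C x"
    and scaleC_one [simp]: "1 *\<^sub>C x = x"

lemma scaleC_zero_left [simp]: "0 *\<^sub>C (x::'a::cvec) = 0"
  using scaleC_add_left[of 0 0 x] by simp

lemma scaleC_zero_right [simp]: "z *\<^sub>C (0::'a::cvec) = 0"
  using scaleC_add_right[of z 0 0] by simp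

lemma scaleC_minus_left: "(- z) *\<^sub>C (x::'a::cvec) = - (z *\<^sub>C x)"
  using scaleC_add_left[of z "- z" x] by (simp add: eq_neg_iff_add_eq_0 add.commute)

lemma scaleC_minus_right: "z *\<^sub>C (- x::'a::cvec) = - (z *\<^sub>C x)"
  using scaleC_add_right[of z x "- x"] by (simp add: eq_neg_iff_add_eq_0 add.commute)

lemma scaleC_diff_right: "z *\<^sub>C (x - y::'a::cvec) = z *\<^sub>C x - z *\<^sub>C y"
  using scaleC_add_right[of z x "- y"] by (simp add: scaleC_minus_right)

lemma scaleC_diff_left: "(w - z) *\<^sub>C (x::'a::cvec) = w *\<^sub>C x - z *\<^sub>C x"
  using scaleC_add_left[of w "- z" x] by (simp add: scaleC_minus_left)

lemma scaleC_sum_right: "z *\<^sub>C (sum f A :: 'a::cvec) = (\<Sum>i\<in>A. z *\<^sub>C f i)"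
  by (induction A rule: infinite_finite_induct) (auto simp: scaleC_add_right)

instantiation complex :: cvec
begin
definition "scaleC_complex (z::complex) (x::complex) = z * x"
instance by standard (auto simp: scaleC_complex_def algebra_simps)
end

instantiation prod :: (cvec, cvec) cvec
begin
definition "scaleC_prod z (x :: 'a \<times> 'b) = (z *\<^sub>C fst x, z *\<^sub>C snd x)"
instance by standard
  (auto simp: scaleC_prod_def plus_prod_def scaleC_add_right scaleC_add_left)
end

lemma scaleC_Pair [simp]: "z *\<^sub>C (x, y) = (z *\<^sub>C x, z *\<^sub>C y)"
  by (simp add: scaleC_prod_def)

instantiation poly_mapping :: (type, cvec) cvec
begin
definition "scaleC_poly_mapping z (v :: 'a \<Rightarrow>\<^sub>0 'b) = Poly_Mapping.map (scaleC z) v"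

lemma lookup_scaleC [simp]: "lookup (z *\<^sub>C (v :: 'a \<Rightarrow>\<^sub>0 'b)) i = z *\<^sub>C lookup v i"
  by (simp add: scaleC_poly_mapping_def map.rep_eq when_def)

instance by standard
  (auto intro!: poly_mapping_eqI simp: lookup_add scaleC_add_right scaleC_add_left)
end

lemma scaleC_single [simp]: "z *\<^sub>C single i (x :: 'b::cvec) = single i (z *\<^sub>C x)"
  by (rule poly_mapping_eqI) (auto simp: lookup_single when_def)

declare scaleC_complex_def [simp]

lemma keys_scaleC: "Poly_Mapping.keys (z *\<^sub>C (v :: 'a \<Rightarrow>\<^sub>0 complex)) \<subseteq> Poly_Mapping.keys v"
  by (auto simp: in_keys_iff)

lemma poly_mapping_sum_singles:
  "v = (\<Sum>i\<in>Poly_Mapping.keys v. single i (lookup v i))"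
  by (rule poly_mapping_eqI)
     (auto simp: lookup_sum lookup_single when_def in_keys_iff)

lemma poly_mapping_linear_induct [case_names single add]:
  fixes v :: "'i \<Rightarrow>\<^sub>0 'b::ab_group_add"
  assumes "\<And>i c. P (single i c)" and "\<And>u v. P u \<Longrightarrow> P v \<Longrightarrow> P (u + v)"
  shows "P v"
proof -
  have "P (\<Sum>i\<in>A. single i (lookup v i))" if "finite A" for A
    using that assms assms(1)[of undefined 0] by (induction A) auto
  from this[OF finite_keys] show ?thesis by (metis poly_mapping_sum_singles)
qed

lemma sum_map_additive:
  fixes f :: "'a::ab_group_add \<Rightarrow> 'b::ab_group_add"
  assumes "\<And>u v. f (u + v) = f u + f v"
  shows "f (sum g A) = (\<Sum>i\<in>A. f (g i))"
proof -
  have "f 0 = 0" using assms[of 0 0] by simp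
  then show ?thesis by (induction A rule: infinite_finite_induct) (auto simp: assms)
qed

definition lin_ext :: "('i \<Rightarrow> 'v::cvec) \<Rightarrow> ('i \<Rightarrow>\<^sub>0 complex) \<Rightarrow> 'v" where
  "lin_ext f v = (\<Sum>i\<in>Poly_Mapping.keys v. lookup v i *\<^sub>C f i)"

lemma lin_ext_superset:
  assumes "finite A" "Poly_Mapping.keys v \<subseteq> A"
  shows "lin_ext f v = (\<Sum>i\<in>A. lookup v i *\<^sub>C f i)"
  unfolding lin_ext_def by (rule sum.mono_neutral_left) (use assms in \<open>auto simp: in_keys_iff\<close>)

lemma lin_ext_add: "lin_ext f (u + v) = lin_ext f u + lin_ext f v"
proof -
  let ?A = "Poly_Mapping.keys u \<union> Poly_Mapping.keys v"
  have "Poly_Mapping.keys (u + v) \<subseteq> ?A" by (rule Poly_Mapping.keys_add)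
  then show ?thesis
    by (simp add: lin_ext_superset[of ?A] lookup_add scaleC_add_left sum.distrib)
qed

lemma lin_ext_diff: "lin_ext f (u - v) = lin_ext f u - lin_ext f v"
  using lin_ext_add[of f "u - v" v] by (simp add: algebra_simps)

lemma lin_ext_scaleC: "lin_ext f (z *\<^sub>C v) = z *\<^sub>C lin_ext f v"
  by (simp add: lin_ext_superset[OF _ keys_scaleC] lin_ext_def[of f v] scaleC_sum_right)

lemma lin_ext_single [simp]: "lin_ext f (single i c) = c *\<^sub>C f i"
  by (simp add: lin_ext_def)

lemma lin_ext_zero [simp]: "lin_ext f 0 = 0"
  by (simp add: lin_ext_def)

section \<open>The function algebra in coordinates\<close>

text \<open>
  The basis vector \<open>(k, m, p)\<close> stands for \<open>a\<^sup>k b\<^sup>m c\<^sup>p\<close> if \<open>k \<ge> 0\<close> and for \<open>d\<^sup>-\<^sup>k b\<^sup>m c\<^sup>p\<close> if \<open>k < 0\<close>.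
\<close>

type_synonym fnspace = "int \<times> nat \<times> nat \<Rightarrow>\<^sub>0 complex"

locale quantum_sphere =
  fixes q :: real
  assumes q_nonzero [simp]: "q \<noteq> 0"
begin

abbreviation Q :: complex where "Q \<equiv> complex_of_real q"

definition qn :: "nat \<Rightarrow> complex" where "qn n = (\<Sum>i<n. Q ^ (2 * i))"

lemma qn_0 [simp]: "qn 0 = 0" by (simp add: qn_def)

lemma qn_Suc: "qn (Suc n) = qn n + Q ^ (2 * n)" by (simp add: qn_def)

lemma qn_1 [simp]: "qn (Suc 0) = 1" by (simp add: qn_Suc)

lemma qn_Suc_front: "qn (Suc n) = 1 + Q\<^sup>2 * qn n"
  unfolding qn_def sum.lessThan_Suc_shift by (simp add: sum_distrib_left power_add power2_eq_square mult.assoc)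

text \<open>
  Left multiplication by \<open>a\<close>.  If the monomial starts with \<open>d\<close>, the product \<open>a d = 1 + q\<^sup>-\<^sup>1 b c\<close>
  cancels that \<open>d\<close> and leaves a second term, in which \<open>b c\<close> has been moved past the remaining \<open>d\<close>'s.
  Left multiplication by \<open>d\<close> works likewise, with \<open>d a = 1 + q b c\<close>.
\<close>

definition La :: "fnspace \<Rightarrow> fnspace" where
  "La = lin_ext (\<lambda>(k, m, p). single (k + 1, m, p) 1 +
     (if k < 0 then single (k + 1, m + 1, p + 1) (Q powi (2 * k + 1)) else 0))"

definition Ld :: "fnspace \<Rightarrow> fnspace" where
  "Ld = lin_ext (\<lambda>(k, m, p). single (k - 1, m, p) 1 +
     (if k > 0 then single (k - 1, m + 1, p + 1) (Q powi (2 * k - 1)) else 0))"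

definition Lb :: "fnspace \<Rightarrow> fnspace" where
  "Lb = lin_ext (\<lambda>(k, m, p). single (k, m + 1, p) (Q powi k))"

definition Lc :: "fnspace \<Rightarrow> fnspace" where
  "Lc = lin_ext (\<lambda>(k, m, p). single (k, m, p + 1) (Q powi k))"

text \<open>
  The partial derivatives \<open>\<partial>\<^sub>+\<close> and \<open>\<partial>\<^sub>-\<close>, obtained by pushing the twisted Leibniz rule through a basis
  monomial.  The truncated exponents \<open>p - 1\<close> and \<open>m - 1\<close> are harmless: at \<open>p = 0\<close>, respectively
  \<open>m = 0\<close>, the coefficient contains \<open>[0] = 0\<close>.
\<close>

definition Dp :: "fnspace \<Rightarrow> fnspace" where
  "Dp = lin_ext (\<lambda>(k, m, p). single (k - 1, m, p - 1) (Q powi (4 - k - 2 * int p) * qn p) +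
     (if k > 0 then single (k - 1, m + 1, p) (Q powi (3 - k - 2 * int p) * qn (nat k + p)) else 0))"

definition Dm :: "fnspace \<Rightarrow> fnspace" where
  "Dm = lin_ext (\<lambda>(k, m, p). single (k + 1, m - 1, p) (Q powi (- k - 1) * qn m) +
     (if k < 0 then single (k + 1, m, p + 1) (Q powi k * qn (nat (- k) + m)) else 0))"

lemmas op_defs = La_def Lb_def Lc_def Ld_def Dp_def Dm_def

lemma op_add [simp]:
  "La (u + v) = La u + La v" "Lb (u + v) = Lb u + Lb v" "Lc (u + v) = Lc u + Lc v"
  "Ld (u + v) = Ld u + Ld v" "Dp (u + v) = Dp u + Dp v" "Dm (u + v) = Dm u + Dm v"
  by (simp_all add: op_defs lin_ext_add)

lemma op_scaleC [simp]:
  "La (z *\<^sub>C v) = z *\<^sub>C La v" "Lb (z *\<^sub>C v) = z *\<^sub>C Lb v" "Lc (z *\<^sub>C v) = z *\<^sub>C Lc v"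
  "Ld (z *\<^sub>C v) = z *\<^sub>C Ld v" "Dp (z *\<^sub>C v) = z *\<^sub>C Dp v" "Dm (z *\<^sub>C v) = z *\<^sub>C Dm v"
  by (simp_all add: op_defs lin_ext_scaleC)

lemma op_uminus [simp]:
  "La (- v) = - La v" "Lb (- v) = - Lb v" "Lc (- v) = - Lc v"
  "Ld (- v) = - Ld v" "Dp (- v) = - Dp v" "Dm (- v) = - Dm v"
  using op_scaleC[of "-1" v] by (simp_all add: scaleC_minus_left)

lemma op_diff [simp]:
  "La (u - v) = La u - La v" "Lb (u - v) = Lb u - Lb v" "Lc (u - v) = Lc u - Lc v"
  "Ld (u - v) = Ld u - Ld v" "Dp (u - v) = Dp u - Dp v" "Dm (u - v) = Dm u - Dm v"
  using op_add[of u "- v"] by simp_all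

lemma op_zero [simp]: "La 0 = 0" "Lb 0 = 0" "Lc 0 = 0" "Ld 0 = 0" "Dp 0 = 0" "Dm 0 = 0"
  by (simp_all add: op_defs)

lemma La_single: "La (single (k, m, p) c) = single (k + 1, m, p) c +
     (if k < 0 then single (k + 1, m + 1, p + 1) (c * Q powi (2 * k + 1)) else 0)"
  by (simp add: La_def scaleC_add_right)

lemma Ld_single: "Ld (single (k, m, p) c) = single (k - 1, m, p) c +
     (if k > 0 then single (k - 1, m + 1, p + 1) (c * Q powi (2 * k - 1)) else 0)"
  by (simp add: Ld_def scaleC_add_right)

lemma Lb_single: "Lb (single (k, m, p) c) = single (k, m + 1, p) (c * Q powi k)"
  by (simp add: Lb_def)

lemma Lc_single: "Lc (single (k, m, p) c) = single (k, m, p + 1) (c * Q powi k)"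
  by (simp add: Lc_def)

lemma Dp_single: "Dp (single (k, m, p) c) =
   single (k - 1, m, p - 1) (c * (Q powi (4 - k - 2 * int p) * qn p)) +
   (if k > 0 then single (k - 1, m + 1, p) (c * (Q powi (3 - k - 2 * int p) * qn (nat k + p)))
    else 0)"
  by (simp add: Dp_def scaleC_add_right)

lemma Dm_single: "Dm (single (k, m, p) c) =
   single (k + 1, m - 1, p) (c * (Q powi (- k - 1) * qn m)) +
   (if k < 0 then single (k + 1, m, p + 1) (c * (Q powi k * qn (nat (- k) + m))) else 0)"
  by (simp add: Dm_def scaleC_add_right)

lemmas op_single = La_single Lb_single Lc_single Ld_single Dp_single Dm_single

lemma sign_cases [case_names zero pos neg]:
  obtains "(k::int) = 0" | n where "k = int n + 1" | n where "k = - int n - 1"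
proof -
  consider "k = 0" | "k > 0" | "k < 0" by linarith
  then show ?thesis
  proof cases
    case 2 then have "k = int (nat (k - 1)) + 1" by simp then show ?thesis using that by blast
  next
    case 3 then have "k = - int (nat (- k - 1)) - 1" by simp then show ?thesis using that by blast
  qed (use that in blast)
qed

lemma Q_powi:
  "Q powi (i + j) = Q powi i * Q powi j" "Q powi (i - j) = Q powi i / Q powi j"
  "Q powi (2 * i) = Q powi i * Q powi i" "Q powi (i * 2) = Q powi i * Q powi i"
  "Q powi (- i) = inverse (Q powi i)"
  using power_int_add[of Q i i]
  by (simp_all add: power_int_add power_int_diff power_int_minus mult.commute)

lemma Q_power_double: "Q ^ (2 * n) = Q ^ n * Q ^ n" "Q ^ (n * 2) = Q ^ n * Q ^ n"
  by (simp_all add: mult_2 mult_2_right power_add)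

lemma nat_shift: "nat (int n + 1) = Suc n" "nat (1 + int n) = Suc n"
  "nat (int n + 2) = Suc (Suc n)"
  by simp_all

lemmas op_simps = op_single Q_powi Q_power_double nat_shift scaleC_add_right

lemmas coefficient_simps = lookup_add lookup_single when_def Q_power_double nat_shift
  power_add power2_eq_square power3_eq_cube power4_eq_xxxx

lemma fnspace_induct [case_names single add]:
  fixes v :: fnspace
  assumes "\<And>k m p c. P (single (k, m, p) c)" and "\<And>u v. P u \<Longrightarrow> P v \<Longrightarrow> P (u + v)"
  shows "P v"
  by (rule poly_mapping_linear_induct[of P]) (use assms in auto)

lemma function_relations_single:
  fixes k :: int and m p :: nat and c :: complex
  defines "v \<equiv> single (k, m, p) c"
  shows "Lb (La v) = Q *\<^sub>C La (Lb v)"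
    "Lc (La v) = Q *\<^sub>C La (Lc v)"
    "Ld (Lb v) = Q *\<^sub>C Lb (Ld v)"
    "Ld (Lc v) = Q *\<^sub>C Lc (Ld v)"
    "Lc (Lb v) = Lb (Lc v)"
    "La (Ld v) = v + (1 / Q) *\<^sub>C Lb (Lc v)"
    "Ld (La v) = v + Q *\<^sub>C Lb (Lc v)"
  unfolding v_def
  by (cases k rule: sign_cases; cases m; cases p; hypsubst; rule poly_mapping_eqI;
      (simp add: op_simps)?; auto simp: coefficient_simps  field_simps; fail)+

lemma function_relations:
  shows "Lb (La v) = Q *\<^sub>C La (Lb v)"
    "Lc (La v) = Q *\<^sub>C La (Lc v)"
    "Ld (Lb v) = Q *\<^sub>C Lb (Ld v)"
    "Ld (Lc v) = Q *\<^sub>C Lc (Ld v)"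
    "Lc (Lb v) = Lb (Lc v)"
    "La (Ld v) = v + (1 / Q) *\<^sub>C Lb (Lc v)"
    "Ld (La v) = v + Q *\<^sub>C Lb (Lc v)"
  by (induction v rule: fnspace_induct)
     (simp_all only: function_relations_single, simp_all add: scaleC_add_right)

lemma Dp_leibniz_single:
  fixes k :: int and m p :: nat and c :: complex
  defines "v \<equiv> single (k, m, p) c"
  shows "Dp (La v) = Q\<^sup>2 *\<^sub>C Lb v + (1 / Q) *\<^sub>C La (Dp v)"
    "Dp (Lb v) = Q *\<^sub>C Lb (Dp v)"
    "Dp (Lc v) = Q\<^sup>2 *\<^sub>C Ld v + (1 / Q) *\<^sub>C Lc (Dp v)"
    "Dp (Ld v) = Q *\<^sub>C Ld (Dp v)"
  unfolding v_def
  by (cases k rule: sign_cases; cases m; cases p; hypsubst; rule poly_mapping_eqI;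
      (simp add: op_simps)?; auto simp: coefficient_simps qn_Suc field_simps; fail)+

text \<open>
  The twisted Leibniz rule for a generator \<open>g\<close> of grade \<open>n\<close>: moving \<open>e\<^sup>+\<close> or \<open>e\<^sup>-\<close> to the left past \<open>g\<close> costs
  \<open>q\<^sup>-\<^sup>n\<close>, so \<open>\<partial> (g f) = (\<partial> g) f + q\<^sup>-\<^sup>n g (\<partial> f)\<close>.  For \<open>\<partial>\<^sub>+\<close> the coefficients match by
  \<open>[n + 1] = [n] + q\<^sup>2\<^sup>n\<close>, for \<open>\<partial>\<^sub>-\<close> by \<open>[n + 1] = 1 + q\<^sup>2 [n]\<close>.
\<close>

lemma Dp_leibniz:
  shows "Dp (La v) = Q\<^sup>2 *\<^sub>C Lb v + (1 / Q) *\<^sub>C La (Dp v)"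
    "Dp (Lb v) = Q *\<^sub>C Lb (Dp v)"
    "Dp (Lc v) = Q\<^sup>2 *\<^sub>C Ld v + (1 / Q) *\<^sub>C Lc (Dp v)"
    "Dp (Ld v) = Q *\<^sub>C Ld (Dp v)"
  by (induction v rule: fnspace_induct)
     (simp_all only: Dp_leibniz_single, simp_all add: scaleC_add_right)

lemma Dm_leibniz_single:
  fixes k :: int and m p :: nat and c :: complex
  defines "v \<equiv> single (k, m, p) c"
  shows "Dm (La v) = (1 / Q) *\<^sub>C La (Dm v)"
    "Dm (Lb v) = (1 / Q) *\<^sub>C La v + Q *\<^sub>C Lb (Dm v)"
    "Dm (Lc v) = (1 / Q) *\<^sub>C Lc (Dm v)"
    "Dm (Ld v) = (1 / Q) *\<^sub>C Lc v + Q *\<^sub>C Ld (Dm v)"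
  unfolding v_def
  by (cases k rule: sign_cases; cases m; cases p; hypsubst; rule poly_mapping_eqI;
      (simp add: op_simps)?; auto simp: coefficient_simps qn_Suc_front field_simps; fail)+

lemma Dm_leibniz:
  shows "Dm (La v) = (1 / Q) *\<^sub>C La (Dm v)"
    "Dm (Lb v) = (1 / Q) *\<^sub>C La v + Q *\<^sub>C Lb (Dm v)"
    "Dm (Lc v) = (1 / Q) *\<^sub>C Lc (Dm v)"
    "Dm (Ld v) = (1 / Q) *\<^sub>C Lc v + Q *\<^sub>C Ld (Dm v)"
  by (induction v rule: fnspace_induct)
     (simp_all only: Dm_leibniz_single, simp_all add: scaleC_add_right)

end

section \<open>The action of the free algebra on forms\<close>

lemma const_mult: "const z * u = z *\<^sub>C u"
  unfolding const_def scaleC_poly_mapping_def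
  using mult_map_scale_conv_mult[of z u] by (simp add: fun_eq_iff[symmetric] scaleC_complex_def[abs_def])

lemma scaleC_mult_left [simp]: "(z *\<^sub>C u) * v = z *\<^sub>C (u * (v :: free))"
  by (simp flip: const_mult add: mult.assoc)

lemma scaleC_mult_right [simp]: "u * (z *\<^sub>C v) = z *\<^sub>C (u * (v :: free))"
proof (induction u rule: poly_mapping_linear_induct)
  case (single i c)
  show ?case
    by (induction v rule: poly_mapping_linear_induct)
       (simp_all add: mult_single scaleC_add_right algebra_simps)
qed (simp add: algebra_simps scaleC_add_right)

text \<open>
  The quadruple \<open>(u, v, w, t)\<close> stands for \<open>u + e\<^sup>+ v + e\<^sup>- w + e\<^sup>+ e\<^sup>- t\<close>.  With the coefficients on the
  right, a generator of \<open>\<complex>\<^sub>q[SL\<^sub>2]\<close> has to pass \<open>e\<^sup>+\<close> and \<open>e\<^sup>-\<close> before it reaches them; this gives the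
  powers of \<open>q\<close> in \<open>act\<close>.
\<close>

type_synonym formspace = "fnspace \<times> fnspace \<times> fnspace \<times> fnspace"

context quantum_sphere
begin

fun act :: "gen \<Rightarrow> formspace \<Rightarrow> formspace" where
  "act Ga (u, v, w, t) = (La u, (1 / Q) *\<^sub>C La v, (1 / Q) *\<^sub>C La w, (1 / Q\<^sup>2) *\<^sub>C La t)"
| "act Gb (u, v, w, t) = (Lb u, Q *\<^sub>C Lb v, Q *\<^sub>C Lb w, Q\<^sup>2 *\<^sub>C Lb t)"
| "act Gc (u, v, w, t) = (Lc u, (1 / Q) *\<^sub>C Lc v, (1 / Q) *\<^sub>C Lc w, (1 / Q\<^sup>2) *\<^sub>C Lc t)"
| "act Gd (u, v, w, t) = (Ld u, Q *\<^sub>C Ld v, Q *\<^sub>C Ld w, Q\<^sup>2 *\<^sub>C Ld t)"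
| "act Gep (u, v, w, t) = (0, u, 0, w)"
| "act Gem (u, v, w, t) = (0, 0, u, (- Q\<^sup>2) *\<^sub>C v)"

text \<open>
  The differential: \<open>e\<^sup>+\<close> and \<open>e\<^sup>-\<close> are closed, so \<open>d (e\<^sup>+ v + e\<^sup>- w) = - e\<^sup>+ (d v) - e\<^sup>- (d w)\<close>, and
  \<open>e\<^sup>- e\<^sup>+ = - q\<^sup>2 e\<^sup>+ e\<^sup>-\<close>.
\<close>

fun dM :: "formspace \<Rightarrow> formspace" where
  "dM (u, v, w, t) = (0, Dp u, Dm u, Q\<^sup>2 *\<^sub>C Dp w - Dm v)"

lemma act_add: "act g (x + y) = act g x + act g y"
  by (cases g; cases x; cases y; simp add: scaleC_add_right)

lemma act_scaleC: "act g (z *\<^sub>C x) = z *\<^sub>C act g x"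
  by (cases g; cases x; simp add: mult.commute)

lemma act_zero [simp]: "act g 0 = 0"
  using act_scaleC[of g 0 0] by simp

definition act_word :: "word \<Rightarrow> formspace \<Rightarrow> formspace" where
  "act_word w = foldr act (letters w)"

lemma act_word_add: "act_word w (x + y) = act_word w x + act_word w y"
proof -
  have "foldr act l (x + y) = foldr act l x + foldr act l y" for l
    by (induction l) (auto simp: act_add)
  then show ?thesis by (simp add: act_word_def)
qed

lemma act_word_scaleC: "act_word w (z *\<^sub>C x) = z *\<^sub>C act_word w x"
proof -
  have "foldr act l (z *\<^sub>C x) = z *\<^sub>C foldr act l x" for l
    by (induction l) (auto simp: act_scaleC)
  then show ?thesis by (simp add: act_word_def)
qed

lemma act_word_plus: "act_word (w + w') x = act_word w (act_word w' x)"
  by (simp add: act_word_def plus_word_def)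

text \<open>The representation of the free algebra by left multiplications.\<close>

definition rho :: "free \<Rightarrow> formspace \<Rightarrow> formspace" where
  "rho u x = lin_ext (\<lambda>w. act_word w x) u"

lemma rho_single: "rho (single w c) x = c *\<^sub>C act_word w x"
  by (simp add: rho_def)

lemma rho_add_left: "rho (u + v) x = rho u x + rho v x"
  by (simp add: rho_def lin_ext_add)

lemma rho_scaleC_left: "rho (z *\<^sub>C u) x = z *\<^sub>C rho u x"
  by (simp add: rho_def lin_ext_scaleC)

lemma rho_diff_left: "rho (u - v) x = rho u x - rho v x"
  using rho_add_left[of "u - v" v x] by (simp add: algebra_simps)

lemma rho_add_right: "rho u (x + y) = rho u x + rho u y"
  by (induction u rule: poly_mapping_linear_induct)
     (simp_all add: rho_single rho_add_left act_word_add scaleC_add_right)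

lemma rho_scaleC_right: "rho u (z *\<^sub>C x) = z *\<^sub>C rho u x"
  by (induction u rule: poly_mapping_linear_induct)
     (simp_all add: rho_single rho_add_left act_word_scaleC scaleC_add_right mult.commute)

lemma rho_mult: "rho (u * v) x = rho u (rho v x)"
proof (induction u rule: poly_mapping_linear_induct)
  case (single w c)
  show ?case
    by (induction v rule: poly_mapping_linear_induct)
       (simp_all add: mult_single rho_single act_word_plus act_word_scaleC act_word_add
         rho_add_left scaleC_add_right distrib_left)
qed (simp add: distrib_right rho_add_left)

lemma act_word_zero [simp]: "act_word 0 x = x"
  by (simp add: act_word_def zero_word_def)

lemma rho_one [simp]: "rho 1 x = x"
  using rho_single[of 0 1 x] by simp

lemma rho_const [simp]: "rho (const z) x = z *\<^sub>C x"
  by (simp add: const_def rho_single)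

lemma rho_var [simp]: "rho (var g) x = act g x"
  by (simp add: var_def rho_single act_word_def)

text \<open>
  The relations contain \<open>e f = q\<^sup>g f e\<close> for all homogeneous elements \<open>f\<close>, not only for generators;
  the next three lemmas go from generators over words to such \<open>f\<close>.
\<close>

lemma act_form_gen:
  assumes "e \<in> {Gep, Gem}" "g \<notin> {Gep, Gem}"
  shows "act e (act g x) = (Q powi gen_grade g) *\<^sub>C act g (act e x)"
  using assms by (cases x; cases g; auto simp: power2_eq_square power_int_minus field_simps
      scaleC_minus_left scaleC_minus_right)

lemma act_form_word:
  assumes "e \<in> {Gep, Gem}" "word_deg w = 0"
  shows "act e (act_word w x) = (Q powi word_grade w) *\<^sub>C act_word w (act e x)"
proof -
  have "act e (foldr act l x) = (Q powi (\<Sum>g\<leftarrow>l. gen_grade g)) *\<^sub>C foldr act l (act e x)"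
    if "\<forall>g\<in>set l. g \<notin> {Gep, Gem}" for l
    using that
  proof (induction l)
    case (Cons g l)
    then show ?case
      using act_form_gen[OF assms(1), of g]
      by (simp add: act_scaleC Q_powi mult.commute)
  qed simp
  moreover have "\<forall>g\<in>set (letters w). g \<notin> {Gep, Gem}"
    using assms(2) by (auto simp: word_deg_def filter_empty_conv)
  ultimately show ?thesis by (simp add: act_word_def word_grade_def)
qed

lemma act_form_rho:
  assumes e: "e \<in> {Gep, Gem}" and w: "\<forall>w\<in>Poly_Mapping.keys f. word_deg w = 0 \<and> word_grade w = g"
  shows "act e (rho f x) = (Q powi g) *\<^sub>C rho f (act e x)"
proof -
  have *: "act e (\<Sum>w\<in>A. lookup f w *\<^sub>C act_word w x) = (\<Sum>w\<in>A. act e (lookup f w *\<^sub>C act_word w x))"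
    for A by (induction A rule: infinite_finite_induct) (auto simp: act_add)
  show ?thesis
    unfolding rho_def lin_ext_def * scaleC_sum_right
    by (rule sum.cong) (use w in \<open>simp_all add: act_scaleC act_form_word[OF e] mult.commute\<close>)
qed

lemma rho_relations:
  assumes "r \<in> relations q"
  shows "rho r x = 0"
proof -
  obtain u v w t where x: "x = (u, v, w, t)" by (cases x)
  note rho_simps = rho_diff_left rho_add_left rho_mult
  from assms consider
      "r = var Gb * var Ga - const q * var Ga * var Gb"
    | "r = var Gc * var Ga - const q * var Ga * var Gc"
    | "r = var Gd * var Gb - const q * var Gb * var Gd"
    | "r = var Gd * var Gc - const q * var Gc * var Gd"
    | "r = var Gc * var Gb - var Gb * var Gc"
    | "r = var Gd * var Ga - var Ga * var Gd - const (q * (1 - q powi (-2))) * var Gb * var Gc"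
    | "r = var Ga * var Gd - const (q powi (-1)) * var Gb * var Gc - 1"
    | e f g where "r = var e * f - const (q powi g) * f * var e" "e \<in> {Gep, Gem}"
        "\<forall>w\<in>Poly_Mapping.keys f. word_deg w = 0 \<and> word_grade w = g"
    | "r = const (q\<^sup>2) * var Gep * var Gem + var Gem * var Gep"
    | "r = var Gep * var Gep" | "r = var Gem * var Gem"
    unfolding relations_def by blast
  then show ?thesis
  proof cases
    case (8 e f g)
    then show ?thesis using act_form_rho[OF 8(2,3)] by (simp add: rho_simps)
  qed (hypsubst; auto simp: x rho_simps function_relations zero_prod_def scaleC_add_right scaleC_minus_left
       power_int_minus scaleC_diff_left lookup_add lookup_minus field_simps power2_eq_square
      intro!: poly_mapping_eqI)+
qed

end

section \<open>The quotient algebra and its normal form\<close>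

lemma ring_free_ring: "ring free_ring"
proof -
  have "\<exists>y. x + y = 0" for x :: free by (rule exI[of _ "- x"]) simp
  then show ?thesis
    by (intro ringI abelian_groupI monoidI) (auto simp: free_ring_def algebra_simps)
qed

lemma free_ring_sel [simp]:
  "carrier free_ring = UNIV" "x \<otimes>\<^bsub>free_ring\<^esub> y = x * y" "x \<oplus>\<^bsub>free_ring\<^esub> y = x + y"
  "\<one>\<^bsub>free_ring\<^esub> = 1" "\<zero>\<^bsub>free_ring\<^esub> = 0"
  by (simp_all add: free_ring_def)

lemma a_inv_free_ring [simp]: "\<ominus>\<^bsub>free_ring\<^esub> x = - x"
proof -
  interpret ring free_ring by (rule ring_free_ring)
  show ?thesis using minus_equality[of "- x" x] by simp
qed

lemma ideal_free_ringI:
  assumes "0 \<in> I" "\<And>u v. u \<in> I \<Longrightarrow> v \<in> I \<Longrightarrow> u + v \<in> I"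
    "\<And>u v. v \<in> I \<Longrightarrow> u * v \<in> I" "\<And>u v. v \<in> I \<Longrightarrow> v * u \<in> I"
  shows "ideal I free_ring"
proof -
  interpret ring free_ring by (rule ring_free_ring)
  have "inv\<^bsub>add_monoid free_ring\<^esub> v \<in> I" if "v \<in> I" for v
    using assms(3)[OF that, of "- 1"] a_inv_free_ring[of v] by (simp add: a_inv_def)
  then show ?thesis
    using assms by (intro idealI ring_free_ring subgroup.intro) auto
qed

context quantum_sphere
begin

abbreviation rels :: "free set" where "rels \<equiv> Idl\<^bsub>free_ring\<^esub> relations q"

lemma ideal_rels: "ideal rels free_ring"
  by (rule ring.genideal_ideal[OF ring_free_ring]) simp

sublocale rels: ideal rels free_ring by (rule ideal_rels)
sublocale quot: ring "free_ring Quot rels" by (rule rels.quotient_is_ring)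

lemma Hq_sel:
  "carrier (Hq q) = carrier (free_ring Quot rels)" "monoid.mult (Hq q) = monoid.mult (free_ring Quot rels)"
  "one (Hq q) = one (free_ring Quot rels)" "zero (Hq q) = zero (free_ring Quot rels)"
  "add (Hq q) = add (free_ring Quot rels)"
  "z \<odot>\<^bsub>Hq q\<^esub> x = cl q (const z) \<otimes>\<^bsub>free_ring Quot rels\<^esub> x"
  by (simp_all add: Hq_def Let_def)

lemma carrier_Hq: "carrier (Hq q) = range (cl q)"
  unfolding Hq_sel cl_def by (auto simp: FactRing_def A_RCOSETS_def')

lemma cl_closed [simp]: "cl q u \<in> carrier (Hq q)"
  unfolding carrier_Hq by simp

lemma cl_mult: "cl q u \<otimes>\<^bsub>Hq q\<^esub> cl q v = cl q (u * v)"
  using ring_hom_mult[OF rels.rcos_ring_hom, of u v] by (simp add: cl_def Hq_sel)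

lemma cl_add: "cl q u \<oplus>\<^bsub>Hq q\<^esub> cl q v = cl q (u + v)"
  using ring_hom_add[OF rels.rcos_ring_hom, of u v] by (simp add: cl_def Hq_sel)

lemma cl_one: "\<one>\<^bsub>Hq q\<^esub> = cl q 1"
  using ring_hom_one[OF rels.rcos_ring_hom] by (simp add: cl_def Hq_sel)

lemma cl_zero: "\<zero>\<^bsub>Hq q\<^esub> = cl q 0"
  using ring_hom_zero[OF rels.rcos_ring_hom ring_free_ring quot.ring_axioms]
  by (simp add: cl_def Hq_sel)

lemma cl_smult: "z \<odot>\<^bsub>Hq q\<^esub> cl q u = cl q (z *\<^sub>C u)"
  using cl_mult[of "const z" u] by (simp add: const_mult Hq_sel)

lemma ring_Hq: "ring (Hq q)"
proof -
  have "\<exists>y. cl q (y + x) = cl q 0" for x by (rule exI[of _ "- x"]) simp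
  then show ?thesis
    by (intro ringI abelian_groupI monoidI)
       (auto simp: carrier_Hq cl_mult cl_add cl_one cl_zero algebra_simps)
qed

lemma cl_eq_iff: "cl q u = cl q v \<longleftrightarrow> u - v \<in> rels"
  using ring.quotient_eq_iff_same_a_r_cos[OF ring_free_ring ideal_rels, of u v]
  by (simp add: cl_def a_minus_def)

text \<open>
  Rewriting takes place in the free algebra, which is a type-class ring, modulo this congruence; only the
  results are transported to the quotient.
\<close>

definition congr :: "free \<Rightarrow> free \<Rightarrow> bool" (infix "\<approx>" 50) where
  "u \<approx> v \<longleftrightarrow> u - v \<in> rels"

lemma congr_iff_cl: "u \<approx> v \<longleftrightarrow> cl q u = cl q v"
  by (simp add: congr_def cl_eq_iff)

lemma congr_refl [simp, intro]: "u \<approx> u" and congr_sym: "u \<approx> v \<Longrightarrow> v \<approx> u"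
  and congr_trans [trans]: "u \<approx> v \<Longrightarrow> v \<approx> w \<Longrightarrow> u \<approx> w"
  by (simp_all add: congr_iff_cl)

lemma congr_add: "u \<approx> u' \<Longrightarrow> v \<approx> v' \<Longrightarrow> u + v \<approx> u' + v'"
  by (simp add: congr_iff_cl flip: cl_add)

lemma congr_mult: "u \<approx> u' \<Longrightarrow> v \<approx> v' \<Longrightarrow> u * v \<approx> u' * v'"
  by (simp add: congr_iff_cl flip: cl_mult)

lemma congr_mult_left: "v \<approx> v' \<Longrightarrow> u * v \<approx> u * v'"
  by (rule congr_mult) auto

lemma congr_mult_right: "v \<approx> v' \<Longrightarrow> v * u \<approx> v' * u"
  by (rule congr_mult) auto

lemma congr_scaleC: "u \<approx> v \<Longrightarrow> z *\<^sub>C u \<approx> z *\<^sub>C v"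
  by (simp add: congr_iff_cl flip: cl_smult)

lemma congr_relation: "u - v \<in> relations q \<Longrightarrow> u \<approx> v"
  unfolding congr_def using ring.genideal_self[OF ring_free_ring, of "relations q"] by auto

lemma rho_zero_left [simp]: "rho 0 x = 0"
  by (simp add: rho_def)

lemma rho_zero_right [simp]: "rho u 0 = 0"
  using rho_scaleC_right[of u 0 0] by simp

text \<open>The elements acting as zero form an ideal that contains the relations.\<close>

lemma rho_congr:
  assumes "u \<approx> v" shows "rho u x = rho v x"
proof -
  have "rels \<subseteq> {u. \<forall>x. rho u x = 0}"
    by (rule ring.genideal_minimal[OF ring_free_ring ideal_free_ringI])
       (auto simp: rho_relations rho_add_left rho_mult rho_zero_left rho_zero_right
          simp del: split_paired_All)
  then have "rho (u - v) x = 0" using assms unfolding congr_def by blast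
  then show ?thesis by (simp add: rho_diff_left)
qed


lemma generator_relations:
  "var Gb * var Ga \<approx> Q *\<^sub>C (var Ga * var Gb)"
  "var Gc * var Ga \<approx> Q *\<^sub>C (var Ga * var Gc)"
  "var Gd * var Gb \<approx> Q *\<^sub>C (var Gb * var Gd)"
  "var Gd * var Gc \<approx> Q *\<^sub>C (var Gc * var Gd)"
  "var Gc * var Gb \<approx> var Gb * var Gc"
  "var Gd * var Ga \<approx> var Ga * var Gd + (Q * (1 - 1 / Q\<^sup>2)) *\<^sub>C (var Gb * var Gc)"
  "var Ga * var Gd \<approx> (1 / Q) *\<^sub>C (var Gb * var Gc) + 1"
  "var Gem * var Gep \<approx> (- Q\<^sup>2) *\<^sub>C (var Gep * var Gem)"
  "var Gep * var Gep \<approx> 0"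
  "var Gem * var Gem \<approx> 0"
  by (rule congr_relation; simp add: relations_def const_mult diff_diff_eq scaleC_minus_left
      power_int_minus field_simps; fail)+

lemma da_relation: "var Gd * var Ga \<approx> Q *\<^sub>C (var Gb * var Gc) + 1"
proof -
  have "var Gd * var Ga \<approx> var Ga * var Gd + (Q * (1 - 1 / Q\<^sup>2)) *\<^sub>C (var Gb * var Gc)"
    by (rule generator_relations)
  also have "\<dots> \<approx> ((1 / Q) *\<^sub>C (var Gb * var Gc) + 1) + (Q * (1 - 1 / Q\<^sup>2)) *\<^sub>C (var Gb * var Gc)"
    by (intro congr_add generator_relations congr_refl)
  also have "\<dots> = (1 / Q + Q * (1 - 1 / Q\<^sup>2)) *\<^sub>C (var Gb * var Gc) + 1"
    by (simp add: scaleC_add_left)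
  also have "1 / Q + Q * (1 - 1 / Q\<^sup>2) = Q" by (simp add: field_simps power2_eq_square)
  finally show ?thesis .
qed

text \<open>The commutation relation read from right to left, so that it moves \<open>e\<^sup>+\<close> and \<open>e\<^sup>-\<close> to the front.\<close>

lemma fn_form_relation:
  assumes "e \<in> {Gep, Gem}" "g \<notin> {Gep, Gem}"
  shows "var g * var e \<approx> (Q powi (- gen_grade g)) *\<^sub>C (var e * var g)"
proof -
  have "var e * var g \<approx> (Q powi gen_grade g) *\<^sub>C (var g * var e)"
  proof (rule congr_relation)
    have "var e * var g - const (complex_of_real (q powi gen_grade g)) * var g * var e \<in> relations q"
      unfolding relations_def using assms
      by (intro UnI1 UnI2 CollectI exI[of _ e] exI[of _ "var g"] exI[of _ "gen_grade g"])
         (auto simp: var_def word_deg_def word_grade_def)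
    then show "var e * var g - Q powi gen_grade g *\<^sub>C (var g * var e) \<in> relations q"
      by (simp add: const_mult)
  qed
  from congr_scaleC[OF congr_sym[OF this], of "Q powi (- gen_grade g)"]
  show ?thesis by (simp add: power_int_minus)
qed

lemma congr_commute_power:
  assumes "x * y \<approx> z *\<^sub>C (y * x)"
  shows "x * y ^ n \<approx> z ^ n *\<^sub>C (y ^ n * x)"
proof (induction n)
  case (Suc n)
  have "x * y ^ Suc n = (x * y) * y ^ n" by (simp add: mult.assoc)
  also have "\<dots> \<approx> (z *\<^sub>C (y * x)) * y ^ n" by (rule congr_mult_right[OF assms])
  also have "\<dots> = z *\<^sub>C (y * (x * y ^ n))" by (simp add: mult.assoc)
  also have "\<dots> \<approx> z *\<^sub>C (y * (z ^ n *\<^sub>C (y ^ n * x)))"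
    by (intro congr_scaleC congr_mult_left Suc.IH)
  also have "\<dots> = z ^ Suc n *\<^sub>C (y ^ Suc n * x)" by (simp add: mult.assoc)
  finally show ?case .
qed simp

definition adpow :: "int \<Rightarrow> free" where
  "adpow k = (if k \<ge> 0 then var Ga ^ nat k else var Gd ^ nat (- k))"

lemma commute_adpow:
  assumes "g \<in> {Gb, Gc}"
  shows "var g * adpow k \<approx> Q powi k *\<^sub>C (adpow k * var g)"
proof -
  have a: "var g * var Ga \<approx> Q *\<^sub>C (var Ga * var g)" using assms generator_relations by auto
  have "var Gd * var g \<approx> Q *\<^sub>C (var g * var Gd)" using assms generator_relations by auto
  from congr_scaleC[OF congr_sym[OF this], of "1 / Q"]
  have d: "var g * var Gd \<approx> (1 / Q) *\<^sub>C (var Gd * var g)" by simp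
  show ?thesis
    using congr_commute_power[OF a, of "nat k"] congr_commute_power[OF d, of "nat (- k)"]
    by (simp add: adpow_def power_int_def inverse_eq_divide)
qed

definition nword :: "int \<times> nat \<times> nat \<Rightarrow> word" where
  "nword = (\<lambda>(k, m, p). Word (replicate (nat k) Ga @ replicate (nat (- k)) Gd @
     replicate m Gb @ replicate p Gc))"

definition nmon :: "int \<times> nat \<times> nat \<Rightarrow> free" where
  "nmon i = single (nword i) 1"

lemma single_Word_append: "single (Word (l @ l')) (1::complex) = single (Word l) 1 * single (Word l') 1"
  by (simp add: mult_single plus_word_def)

lemma single_Word_replicate: "single (Word (replicate n g)) (1::complex) = var g ^ n"
proof (induction n)
  case 0 then show ?case by (simp flip: zero_word_def)
next
  case (Suc n) then show ?case
    using single_Word_append[of "[g]" "replicate n g"] by (simp add: var_def)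
qed

lemma nmon_eq: "nmon (k, m, p) = adpow k * var Gb ^ m * var Gc ^ p"
  by (simp add: nmon_def nword_def single_Word_append single_Word_replicate adpow_def mult.assoc)

definition emb :: "fnspace \<Rightarrow> free" where "emb = lin_ext nmon"

lemma emb_add: "emb (u + v) = emb u + emb v"
  and emb_scaleC: "emb (z *\<^sub>C v) = z *\<^sub>C emb v"
  and emb_single: "emb (single i c) = c *\<^sub>C nmon i"
  and emb_zero [simp]: "emb 0 = 0"
  by (simp_all add: emb_def lin_ext_add lin_ext_scaleC)

lemma mult_b_nmon: "var Gb * nmon (k, m, p) \<approx> Q powi k *\<^sub>C nmon (k, Suc m, p)"
proof -
  have "var Gb * nmon (k, m, p) = (var Gb * adpow k) * (var Gb ^ m * var Gc ^ p)"
    by (simp add: nmon_eq mult.assoc)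
  also have "\<dots> \<approx> (Q powi k *\<^sub>C (adpow k * var Gb)) * (var Gb ^ m * var Gc ^ p)"
    by (intro congr_mult_right commute_adpow) simp
  also have "\<dots> = Q powi k *\<^sub>C nmon (k, Suc m, p)" by (simp add: nmon_eq mult.assoc)
  finally show ?thesis .
qed

lemma mult_c_nmon: "var Gc * nmon (k, m, p) \<approx> Q powi k *\<^sub>C nmon (k, m, Suc p)"
proof -
  have "var Gc * nmon (k, m, p) = (var Gc * adpow k) * (var Gb ^ m * var Gc ^ p)"
    by (simp add: nmon_eq mult.assoc)
  also have "\<dots> \<approx> (Q powi k *\<^sub>C (adpow k * var Gc)) * (var Gb ^ m * var Gc ^ p)"
    by (intro congr_mult_right commute_adpow) simp
  also have "\<dots> = Q powi k *\<^sub>C (adpow k * (var Gc * var Gb ^ m) * var Gc ^ p)"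
    by (simp add: mult.assoc)
  also have "\<dots> \<approx> Q powi k *\<^sub>C (adpow k * (1 ^ m *\<^sub>C (var Gb ^ m * var Gc)) * var Gc ^ p)"
    by (intro congr_scaleC congr_mult_right congr_mult_left congr_commute_power)
       (simp add: generator_relations)
  also have "\<dots> = Q powi k *\<^sub>C nmon (k, m, Suc p)" by (simp add: nmon_eq mult.assoc)
  finally show ?thesis .
qed

lemma mult_bc_nmon: "(var Gb * var Gc) * nmon (k, m, p) \<approx> Q powi (2 * k) *\<^sub>C nmon (k, Suc m, Suc p)"
proof -
  have "(var Gb * var Gc) * nmon (k, m, p) = var Gb * (var Gc * nmon (k, m, p))"
    by (simp add: mult.assoc)
  also have "\<dots> \<approx> var Gb * (Q powi k *\<^sub>C nmon (k, m, Suc p))"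
    by (intro congr_mult_left mult_c_nmon)
  also have "\<dots> = Q powi k *\<^sub>C (var Gb * nmon (k, m, Suc p))" by simp
  also have "\<dots> \<approx> Q powi k *\<^sub>C (Q powi k *\<^sub>C nmon (k, Suc m, Suc p))"
    by (intro congr_scaleC mult_b_nmon)
  finally show ?thesis by (simp add: Q_powi)
qed

lemma mult_ad_nmon:
  assumes "x * y \<approx> z *\<^sub>C (var Gb * var Gc) + 1" "nmon (k, m, p) = y * nmon (k', m, p)"
  shows "x * nmon (k, m, p) \<approx> nmon (k', m, p) + (z * Q powi (2 * k')) *\<^sub>C nmon (k', Suc m, Suc p)"
proof -
  have "x * nmon (k, m, p) = (x * y) * nmon (k', m, p)" by (simp add: assms(2) mult.assoc)
  also have "\<dots> \<approx> (z *\<^sub>C (var Gb * var Gc) + 1) * nmon (k', m, p)"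
    by (intro congr_mult_right assms(1))
  also have "\<dots> = nmon (k', m, p) + z *\<^sub>C ((var Gb * var Gc) * nmon (k', m, p))"
    by (simp add: distrib_right)
  also have "\<dots> \<approx> nmon (k', m, p) + z *\<^sub>C (Q powi (2 * k') *\<^sub>C nmon (k', Suc m, Suc p))"
    by (intro congr_add congr_refl congr_scaleC mult_bc_nmon)
  finally show ?thesis by simp
qed

lemma adpow_shift:
  "k \<ge> 0 \<Longrightarrow> adpow (k + 1) = var Ga * adpow k" "k \<le> 0 \<Longrightarrow> adpow (k - 1) = var Gd * adpow k"
proof -
  show "adpow (k + 1) = var Ga * adpow k" if "k \<ge> 0"
    using that by (simp add: adpow_def nat_add_distrib)
  show "adpow (k - 1) = var Gd * adpow k" if "k \<le> 0"
  proof -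
    have "nat (- (k - 1)) = Suc (nat (- k))" using that by simp
    then show ?thesis using that by (cases "k = 0") (simp_all add: adpow_def del: neg_equal_0_iff_equal)
  qed
qed

text \<open>
  The formulas for the operators on coordinates are consequences of the relations: normal forms are
  closed, up to congruence, under left multiplication by the generators.
\<close>

lemma mult_emb:
  "var Ga * emb v \<approx> emb (La v)" "var Gb * emb v \<approx> emb (Lb v)"
  "var Gc * emb v \<approx> emb (Lc v)" "var Gd * emb v \<approx> emb (Ld v)"
proof (induction v rule: fnspace_induct)
  case (single k m p c)
  {
    case 1
    have "var Ga * nmon (k, m, p) \<approx> emb (La (single (k, m, p) 1))"
    proof (cases "k < 0")
      case True
      have "nmon (k, m, p) = var Gd * nmon (k + 1, m, p)"
        using adpow_shift(2)[of "k + 1"] True by (simp add: nmon_eq mult.assoc)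
      from mult_ad_nmon[OF generator_relations(7) this] show ?thesis
        using True by (simp add: La_single emb_add emb_single Q_powi power2_eq_square mult.assoc)
    next
      case False
      then have "var Ga * nmon (k, m, p) = nmon (k + 1, m, p)"
        using adpow_shift(1)[of k] by (simp add: nmon_eq mult.assoc)
      then show ?thesis using False by (simp add: La_single emb_add emb_single)
    qed
    from congr_scaleC[OF this, of c] show ?case by (simp add: emb_single flip: emb_scaleC op_scaleC)
  next
    case 2 show ?case
      using congr_scaleC[OF mult_b_nmon, of c k m p] by (simp add: emb_single Lb_single)
  next
    case 3 show ?case
      using congr_scaleC[OF mult_c_nmon, of c k m p] by (simp add: emb_single Lc_single)
  next
    case 4
    have "var Gd * nmon (k, m, p) \<approx> emb (Ld (single (k, m, p) 1))"
    proof (cases "k > 0")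
      case True
      have "nmon (k, m, p) = var Ga * nmon (k - 1, m, p)"
        using adpow_shift(1)[of "k - 1"] True by (simp add: nmon_eq mult.assoc)
      from mult_ad_nmon[OF da_relation this] show ?thesis
        using True by (simp add: Ld_single emb_add emb_single Q_powi power2_eq_square)
    next
      case False
      then have "var Gd * nmon (k, m, p) = nmon (k - 1, m, p)"
        using adpow_shift(2)[of k] by (simp add: nmon_eq mult.assoc)
      then show ?thesis using False by (simp add: Ld_single emb_add emb_single)
    qed
    from congr_scaleC[OF this, of c] show ?case by (simp add: emb_single flip: emb_scaleC op_scaleC)
  }
next
  case (add u v)
  { case 1 show ?case using congr_add[OF add(1) add(5)] by (simp add: emb_add distrib_left)
  next case 2 show ?case using congr_add[OF add(2) add(6)] by (simp add: emb_add distrib_left)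
  next case 3 show ?case using congr_add[OF add(3) add(7)] by (simp add: emb_add distrib_left)
  next case 4 show ?case using congr_add[OF add(4) add(8)] by (simp add: emb_add distrib_left) }
qed


text \<open>The normal form with the given coordinates, with \<open>e\<^sup>+\<close> and \<open>e\<^sup>-\<close> in front.\<close>

fun nf :: "formspace \<Rightarrow> free" where
  "nf (u, v, w, t) = emb u + var Gep * emb v + var Gem * emb w + var Gep * (var Gem * emb t)"

lemma nf_add: "nf (x + y) = nf x + nf y"
  by (cases x; cases y; simp add: emb_add distrib_left algebra_simps)

lemma nf_scaleC: "nf (z *\<^sub>C x) = z *\<^sub>C nf x"
  by (cases x; simp add: emb_scaleC scaleC_add_right)

lemma nf_zero [simp]: "nf 0 = 0"
  using nf_scaleC[of 0 0] by simp

lemma mult_nf_function: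
  assumes g: "g \<notin> {Gep, Gem}" and L: "\<And>v. var g * emb v \<approx> emb (L v)"
  defines "z \<equiv> Q powi (- gen_grade g)"
  shows "var g * nf (u, v, w, t) \<approx> nf (L u, z *\<^sub>C L v, z *\<^sub>C L w, (z * z) *\<^sub>C L t)"
proof -
  have one: "var g * (var e * f) \<approx> z *\<^sub>C (var e * (var g * f))" if "e \<in> {Gep, Gem}" for e f
    using congr_mult_right[OF fn_form_relation[OF that g], of f] by (simp add: z_def mult.assoc)
  have e: "var g * (var e * emb v) \<approx> z *\<^sub>C (var e * emb (L v))" if "e \<in> {Gep, Gem}" for e v
    using congr_trans[OF one[OF that] congr_scaleC[OF congr_mult_left[OF L]]] .
  have ee: "var g * (var Gep * (var Gem * emb t)) \<approx> z *\<^sub>C (var Gep * (z *\<^sub>C (var Gem * emb (L t))))"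
    using congr_trans[OF one[of Gep] congr_scaleC[OF congr_mult_left[OF e[of Gem]]]] by simp
  have "var g * nf (u, v, w, t) = var g * emb u + var g * (var Gep * emb v) + var g * (var Gem * emb w)
      + var g * (var Gep * (var Gem * emb t))"
    by (simp add: distrib_left)
  also have "\<dots> \<approx> emb (L u) + z *\<^sub>C (var Gep * emb (L v)) + z *\<^sub>C (var Gem * emb (L w))
      + z *\<^sub>C (var Gep * (z *\<^sub>C (var Gem * emb (L t))))"
    by (intro congr_add L e ee) simp_all
  also have "\<dots> = nf (L u, z *\<^sub>C L v, z *\<^sub>C L w, (z * z) *\<^sub>C L t)"
    by (simp add: emb_scaleC)
  finally show ?thesis .
qed

text \<open>
  For the generators \<open>e\<^sup>+\<close> and \<open>e\<^sup>-\<close> some products vanish: those that repeat a factor, and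
  \<open>e\<^sup>- e\<^sup>+ e\<^sup>-\<close>, since \<open>e\<^sup>-\<close> and \<open>e\<^sup>+\<close> commute up to a factor.
\<close>

lemma mult_nf: "var g * nf x \<approx> nf (act g x)"
proof -
  obtain u v w t where x: "x = (u, v, w, t)" by (cases x)
  have kill: "r * f \<approx> 0" if "r \<approx> 0" for r f :: free
    using congr_mult_right[OF that, of f] by simp
  show ?thesis
  proof (cases g)
    case Ga
    then show ?thesis using mult_nf_function[of Ga La] mult_emb
      by (simp add: x power2_eq_square power_int_minus inverse_eq_divide)
  next
    case Gb
    then show ?thesis using mult_nf_function[of Gb Lb] mult_emb
      by (simp add: x power2_eq_square power_int_minus inverse_eq_divide)
  next
    case Gc
    then show ?thesis using mult_nf_function[of Gc Lc] mult_emb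
      by (simp add: x power2_eq_square power_int_minus inverse_eq_divide)
  next
    case Gd
    then show ?thesis using mult_nf_function[of Gd Ld] mult_emb
      by (simp add: x power2_eq_square power_int_minus inverse_eq_divide)
  next
    case Gep
    have "var Gep * nf x = var Gep * emb u + (var Gep * var Gep) * emb v + var Gep * (var Gem * emb w)
        + (var Gep * var Gep) * (var Gem * emb t)"
      by (simp add: x distrib_left mult.assoc)
    also have "\<dots> \<approx> var Gep * emb u + 0 + var Gep * (var Gem * emb w) + 0"
      by (intro congr_add congr_refl kill generator_relations)
    finally show ?thesis by (simp add: x Gep)
  next
    case Gem
    have "(var Gem * var Gep) * var Gem \<approx> ((- Q\<^sup>2) *\<^sub>C (var Gep * var Gem)) * var Gem"
      by (intro congr_mult_right generator_relations)
    also have "\<dots> = (- Q\<^sup>2) *\<^sub>C (var Gep * (var Gem * var Gem))" by (simp add: mult.assoc)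
    also have "\<dots> \<approx> (- Q\<^sup>2) *\<^sub>C (var Gep * 0)"
      by (intro congr_scaleC congr_mult_left generator_relations)
    finally have mpm: "(var Gem * var Gep) * var Gem \<approx> 0" by simp
    have "var Gem * nf x = var Gem * emb u + (var Gem * var Gep) * emb v + (var Gem * var Gem) * emb w
        + ((var Gem * var Gep) * var Gem) * emb t"
      by (simp add: x distrib_left mult.assoc)
    also have "\<dots> \<approx> var Gem * emb u + ((- Q\<^sup>2) *\<^sub>C (var Gep * var Gem)) * emb v + 0 + 0"
      by (intro congr_add congr_refl kill mpm congr_mult_right generator_relations)
    finally show ?thesis by (simp add: x Gem emb_scaleC mult.assoc)
  qed
qed

text \<open>The coordinates of \<open>1\<close>; an element of the algebra is recovered from its action on them.\<close>

definition vac :: formspace where "vac = (single (0, 0, 0) 1, 0, 0, 0)"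

lemma nf_vac: "nf vac = 1"
  by (simp add: vac_def emb_single nmon_eq adpow_def)

lemma nf_act_word: "single (Word l) 1 \<approx> nf (act_word (Word l) vac)"
proof (induction l)
  case Nil
  have "act_word (Word []) vac = vac" by (simp add: act_word_def)
  then show ?case by (simp add: nf_vac) (simp flip: zero_word_def)
next
  case (Cons g l)
  have "single (Word (g # l)) 1 = var g * single (Word l) 1"
    using single_Word_append[of "[g]" l] by (simp add: var_def)
  also have "\<dots> \<approx> var g * nf (act_word (Word l) vac)" by (intro congr_mult_left Cons)
  also have "\<dots> \<approx> nf (act g (act_word (Word l) vac))" by (rule mult_nf)
  finally show ?case by (simp add: act_word_def)
qed

text \<open>Every element is congruent to a normal form: the spanning half of the PBW theorem.\<close>

lemma congr_nf_rho: "u \<approx> nf (rho u vac)"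
proof (induction u rule: poly_mapping_linear_induct)
  case (single w c)
  show ?case
    using congr_scaleC[OF nf_act_word[of "letters w"], of c] by (simp add: rho_single nf_scaleC)
next
  case (add u v)
  then show ?case by (simp add: rho_add_left nf_add congr_add)
qed

lemma rho_c_power: "rho (var Gc ^ n) (single (0, m, p) c, 0, 0, 0) = (single (0, m, p + n) c, 0, 0, 0)"
  by (induction n) (simp_all add: rho_mult Lc_single)

lemma rho_b_power: "rho (var Gb ^ n) (single (0, m, p) c, 0, 0, 0) = (single (0, m + n, p) c, 0, 0, 0)"
  by (induction n) (simp_all add: rho_mult Lb_single)

lemma rho_a_power: "rho (var Ga ^ n) (single (0, m, p) c, 0, 0, 0) = (single (int n, m, p) c, 0, 0, 0)"
  by (induction n) (simp_all add: rho_mult La_single add.commute)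

lemma rho_d_power: "rho (var Gd ^ n) (single (0, m, p) c, 0, 0, 0) = (single (- int n, m, p) c, 0, 0, 0)"
  by (induction n) (simp_all add: rho_mult Ld_single, simp only: diff_conv_add_uminus add.commute)

lemma rho_nmon_vac: "rho (nmon i) vac = (single i 1, 0, 0, 0)"
  by (cases i) (auto simp: nmon_eq vac_def rho_mult rho_c_power rho_b_power adpow_def rho_a_power rho_d_power)

lemma rho_emb_vac: "rho (emb v) vac = (v, 0, 0, 0)"
  by (induction v rule: poly_mapping_linear_induct)
     (simp_all add: emb_single emb_add rho_add_left rho_scaleC_left rho_nmon_vac)

text \<open>The coordinates of a normal form can be read off: the independence half.\<close>

lemma rho_nf_vac: "rho (nf x) vac = x"
  by (cases x) (simp add: rho_add_left rho_mult rho_emb_vac)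

text \<open>
  Hence the ideal of relations consists of the elements that annihilate \<open>vac\<close>, and membership in it
  becomes a computation in coordinates.
\<close>

lemma congr_iff_rho: "u \<approx> v \<longleftrightarrow> rho u vac = rho v vac"
  using rho_congr[of u v vac] congr_nf_rho[of u] congr_nf_rho[of v]
  by (metis congr_sym congr_trans)

lemma rho_nf_rho: "rho (nf (rho u x)) y = rho u (rho (nf x) y)"
proof -
  have "nf (rho u x) \<approx> u * nf x"
    using congr_nf_rho[of "u * nf x"] by (simp add: rho_mult rho_nf_vac congr_sym)
  then show ?thesis using rho_congr rho_mult by metis
qed

text \<open>The linear isomorphism from the model onto the quotient algebra.\<close>

definition form :: "formspace \<Rightarrow> free set" where "form x = cl q (nf x)"

lemma cl_eq_form: "cl q u = form (rho u vac)"
  using congr_nf_rho by (simp add: form_def congr_iff_cl)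

lemma form_eq_iff [simp]: "form x = form y \<longleftrightarrow> x = y"
  by (metis form_def congr_iff_cl congr_iff_rho rho_nf_vac)

lemma form_closed [simp]: "form x \<in> carrier (Hq q)"
  by (simp add: form_def)

lemma carrier_Hq_form: "carrier (Hq q) = range form"
proof
  show "carrier (Hq q) \<subseteq> range form" unfolding carrier_Hq by (auto simp: cl_eq_form)
qed auto

lemma form_add: "form x \<oplus>\<^bsub>Hq q\<^esub> form y = form (x + y)"
  by (simp add: form_def cl_add nf_add)

lemma form_smult: "z \<odot>\<^bsub>Hq q\<^esub> form x = form (z *\<^sub>C x)"
  by (simp add: form_def cl_smult nf_scaleC)

lemma cl_mult_form: "cl q u \<otimes>\<^bsub>Hq q\<^esub> form x = form (rho u x)"
  unfolding form_def[of x] cl_mult unfolding cl_eq_form by (simp add: rho_mult rho_nf_vac)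

lemma form_mult: "form x \<otimes>\<^bsub>Hq q\<^esub> form y = form (rho (nf x) y)"
  unfolding form_def[of x] cl_mult_form ..

lemma form_zero: "\<zero>\<^bsub>Hq q\<^esub> = form 0"
  by (simp add: form_def cl_zero)

lemma form_uminus: "\<ominus>\<^bsub>Hq q\<^esub> form x = form (- x)"
proof -
  interpret ring "Hq q" by (rule ring_Hq)
  show ?thesis by (rule minus_equality) (simp_all add: form_add form_zero)
qed

lemma form_diff: "form x \<ominus>\<^bsub>Hq q\<^esub> form y = form (x - y)"
  by (simp add: a_minus_def form_uminus form_add)

section \<open>The differential\<close>

lemma dM_add: "dM (x + y) = dM x + dM y"
  by (cases x; cases y; simp add: scaleC_add_right algebra_simps)

lemma dM_scaleC: "dM (z *\<^sub>C x) = z *\<^sub>C dM x"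
  by (cases x; simp add: scaleC_diff_right mult.commute)

fun dgen :: "gen \<Rightarrow> free" where
  "dgen Ga = Q *\<^sub>C (var Gb * var Gep)" | "dgen Gb = var Ga * var Gem"
| "dgen Gc = Q *\<^sub>C (var Gd * var Gep)" | "dgen Gd = var Gc * var Gem"
| "dgen Gep = 0" | "dgen Gem = 0"

text \<open>
  The graded Leibniz rule for one generator.  Together with associativity it implies the rule for words
  and then for all elements that are homogeneous in the degree of forms.
\<close>

lemma dM_act:
  "dM (act g x) = rho (dgen g) x + (- 1) ^ word_deg (Word [g]) *\<^sub>C act g (dM x)"
  by (cases x; cases g; auto simp: word_deg_def rho_scaleC_left rho_mult Dp_leibniz Dm_leibniz
     scaleC_add_right scaleC_minus_left
     scaleC_diff_right scaleC_minus_right lookup_add lookup_minus field_simps power2_eq_square zero_prod_def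
     intro!: poly_mapping_eqI)

lemma dM_vac [simp]: "dM vac = 0"
  by (simp add: vac_def Dp_single Dm_single zero_prod_def)

lemma dM_act_word:
  "dM (act_word w x) = rho (nf (dM (act_word w vac))) x + (- 1) ^ word_deg w *\<^sub>C act_word w (dM x)"
proof -
  have "dM (act_word (Word l) x) = rho (nf (dM (act_word (Word l) vac))) x
    + (- 1) ^ word_deg (Word l) *\<^sub>C act_word (Word l) (dM x)" for l
  proof (induction l)
    case Nil
    have "act_word (Word []) y = y" "word_deg (Word []) = 0" for y by (simp_all add: act_word_def word_deg_def)
    then show ?case by simp
  next
    case (Cons g l)
    have [simp]: "act_word (Word (g # l)) y = act g (act_word (Word l) y)" for y
      by (simp add: act_word_def)
    have deg: "word_deg (Word (g # l)) = word_deg (Word [g]) + word_deg (Word l)"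
      by (simp add: word_deg_def)
    have act: "rho (nf (act g y)) z = act g (rho (nf y) z)" for y z
      using rho_nf_rho[of "var g" y z] by simp
    have nfw: "rho (nf (act_word (Word l) vac)) x = act_word (Word l) x"
      using rho_congr[OF nf_act_word[of l], of x] by (simp add: rho_single)
    show ?case
      by (simp add: dM_act nf_add nf_scaleC rho_add_left rho_scaleC_left rho_nf_rho act nfw deg power_add
        Cons act_add act_scaleC scaleC_add_right add.assoc)
  qed
  then show ?thesis by (cases w) auto
qed

lemma dM_rho:
  assumes "\<forall>w\<in>Poly_Mapping.keys u. word_deg w = k"
  shows "dM (rho u x) = rho (nf (dM (rho u vac))) x + (- 1) ^ k *\<^sub>C rho u (dM x)"
proof -
  have sum_dM: "dM (sum f A) = (\<Sum>i\<in>A. dM (f i))" for f and A :: "word set"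
    by (induction A rule: infinite_finite_induct) (auto simp: dM_add zero_prod_def)
  have sum_nf: "rho (nf (sum f A)) x = (\<Sum>i\<in>A. rho (nf (f i)) x)" for f and A :: "word set"
    by (induction A rule: infinite_finite_induct) (auto simp: nf_add rho_add_left)
  show ?thesis
    unfolding rho_def[of u] lin_ext_def sum_dM sum_nf scaleC_sum_right sum.distrib[symmetric]
    by (rule sum.cong[OF refl])
       (subst dM_scaleC, subst dM_act_word,
        use assms in \<open>simp add: dM_scaleC nf_scaleC rho_scaleC_left scaleC_add_right mult.commute\<close>)
qed

lemma el_eq: "cl q (var g) \<otimes>\<^bsub>Hq q\<^esub> form x = form (act g x)"
  by (simp add: cl_mult_form)

text \<open>Transported to the quotient, the operator on coordinates has all properties of a differential.\<close>

lemma is_differential_form: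
  "is_differential q (\<lambda>X. form (dM (the_inv form X)))"
proof -
  have inj: "inj form" by (simp add: inj_on_def)
  have [simp]: "the_inv form (form x) = x" for x by (rule the_inv_f_f[OF inj])
  have cl_inv: "the_inv form (cl q u) = rho u vac" for u by (simp add: cl_eq_form)
  have gen: "form (dM (rho (var g) vac)) = cl q (dgen g)" for g
    unfolding cl_eq_form by (simp add: dM_act[of g vac])
  show ?thesis
    unfolding is_differential_def carrier_Hq_form
  proof (intro conjI allI ballI)
    fix k x y assume "x \<in> forms q k" "y \<in> range form"
    then obtain u m where *: "x = cl q u" "\<forall>w\<in>Poly_Mapping.keys u. word_deg w = k" "y = form m"
      by (auto simp: forms_def)
    show "form (dM (the_inv form (x \<otimes>\<^bsub>Hq q\<^esub> y))) =
       form (dM (the_inv form x)) \<otimes>\<^bsub>Hq q\<^esub> y \<oplus>\<^bsub>Hq q\<^esub>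
       (- 1) ^ k \<odot>\<^bsub>Hq q\<^esub> (x \<otimes>\<^bsub>Hq q\<^esub> form (dM (the_inv form y)))"
      using dM_rho[OF *(2), of m]
      by (simp add: * cl_inv cl_mult_form form_mult form_smult form_add)
  qed (auto simp: form_add form_smult dM_add dM_scaleC cl_inv gen cl_mult cl_smult cl_zero
      scaleC_add_right scaleC_diff_right mult.commute simp del: rho_var)
qed

text \<open>
  A differential kills \<open>1\<close>, since \<open>d 1 = d (1 1) = d 1 + d 1\<close>; the Leibniz rule then determines it on
  words, and linearity everywhere.
\<close>

lemma differential_unique:
  assumes D: "is_differential q D"
  shows "D (form x) = form (dM x)"
proof -
  note D' = D[unfolded is_differential_def]
  have add_D: "D (form x \<oplus>\<^bsub>Hq q\<^esub> form y) = D (form x) \<oplus>\<^bsub>Hq q\<^esub> D (form y)"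
    and scale: "D (z \<odot>\<^bsub>Hq q\<^esub> form x) = z \<odot>\<^bsub>Hq q\<^esub> D (form x)" for x y z
    using D' by simp_all
  have leibniz: "D (cl q u \<otimes>\<^bsub>Hq q\<^esub> form y) = D (cl q u) \<otimes>\<^bsub>Hq q\<^esub> form y
      \<oplus>\<^bsub>Hq q\<^esub> (- 1) ^ k \<odot>\<^bsub>Hq q\<^esub> (cl q u \<otimes>\<^bsub>Hq q\<^esub> D (form y))"
    if "\<forall>w\<in>Poly_Mapping.keys u. word_deg w = k" for u y k
    using D' that by (simp add: forms_def)
  have gen: "D (cl q (var g)) = cl q (dgen g)" for g
    using D' by (cases g) (simp_all add: cl_mult cl_smult cl_zero)
  have "D (form vac) \<in> carrier (Hq q)" using D' by auto
  then obtain y where y: "D (form vac) = form y" by (auto simp: carrier_Hq_form)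
  have one: "cl q 1 = form vac" by (simp add: form_def nf_vac)
  have "D (cl q 1 \<otimes>\<^bsub>Hq q\<^esub> form vac) = D (cl q 1) \<otimes>\<^bsub>Hq q\<^esub> form vac
      \<oplus>\<^bsub>Hq q\<^esub> (- 1) ^ 0 \<odot>\<^bsub>Hq q\<^esub> (cl q 1 \<otimes>\<^bsub>Hq q\<^esub> D (form vac))"
    by (rule leibniz) (simp add: word_deg_def zero_word_def)
  then have "form y = form y \<oplus>\<^bsub>Hq q\<^esub> form y"
    by (simp add: one y form_mult rho_nf_vac nf_vac form_smult)
  then have vac0: "D (form vac) = form 0" by (simp add: y form_add)
  have word: "D (form (act_word (Word l) vac)) = form (dM (act_word (Word l) vac))" for l
  proof (induction l)
    case Nil
    then show ?case using vac0 by (simp add: act_word_def)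
  next
    case (Cons g l)
    let ?x = "act_word (Word l) vac"
    have "D (form (act_word (Word (g # l)) vac)) = D (cl q (var g) \<otimes>\<^bsub>Hq q\<^esub> form ?x)"
      by (simp add: act_word_def el_eq)
    also have "\<dots> = D (cl q (var g)) \<otimes>\<^bsub>Hq q\<^esub> form ?x
      \<oplus>\<^bsub>Hq q\<^esub> (- 1) ^ word_deg (Word [g]) \<odot>\<^bsub>Hq q\<^esub> (cl q (var g) \<otimes>\<^bsub>Hq q\<^esub> D (form ?x))"
      by (rule leibniz) (simp add: var_def)
    also have "\<dots> = form (dM (act g ?x))"
      by (simp add: gen Cons cl_mult_form form_smult form_add dM_act)
    finally show ?case by (simp add: act_word_def)
  qed
  have "D (form (rho u vac)) = form (dM (rho u vac))" for u
  proof (induction u rule: poly_mapping_linear_induct)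
    case (single w c)
    show ?case
      using word[of "letters w"] scale[where z = c and x = "act_word w vac"]
      by (simp add: rho_single form_smult dM_scaleC)
  next
    case (add u v)
    then show ?case using add_D[of "rho u vac" "rho v vac"] by (simp add: rho_add_left dM_add form_add)
  qed
  from this[of "nf x"] show ?thesis by (simp add: rho_nf_vac)
qed

lemma ext_d_form: "ext_d q (form x) = form (dM x)"
  unfolding ext_d_def
  by (rule differential_unique, rule someI[of "is_differential q"], rule is_differential_form)

end

section \<open>Graded pieces and coefficients of forms\<close>

definition grade :: "int \<times> nat \<times> nat \<Rightarrow> int" where
  "grade = (\<lambda>(k, m, p). k - int m + int p)"

definition homog :: "int \<Rightarrow> fnspace set" where
  "homog g = {v. \<forall>i\<in>Poly_Mapping.keys v. grade i = g}"

lemma homog_zero [simp]: "0 \<in> homog g"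
  by (simp add: homog_def)

lemma homog_add: "u \<in> homog g \<Longrightarrow> v \<in> homog g \<Longrightarrow> u + v \<in> homog g"
  unfolding homog_def using Poly_Mapping.keys_add[of u v] by blast

lemma homog_scaleC: "v \<in> homog g \<Longrightarrow> z *\<^sub>C v \<in> homog g"
  unfolding homog_def using keys_scaleC[of z v] by blast

lemma homog_diff: "u \<in> homog g \<Longrightarrow> v \<in> homog g \<Longrightarrow> u - v \<in> homog g"
  using homog_add[OF _ homog_scaleC[of v g "- 1"], of u] by (simp add: scaleC_minus_left)

lemma homog_sum: "(\<And>i. i \<in> A \<Longrightarrow> f i \<in> homog g) \<Longrightarrow> sum f A \<in> homog g"
  by (induction A rule: infinite_finite_induct) (auto simp: homog_add)

lemma homog_single: "c = 0 \<or> grade i = g \<Longrightarrow> single i c \<in> homog g"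
  by (auto simp: homog_def)

lemma homog_lin_ext:
  assumes "v \<in> homog g" "\<And>i. grade i = g \<Longrightarrow> f i \<in> homog h"
  shows "lin_ext f v \<in> homog h"
proof -
  have "grade i = g" if "i \<in> Poly_Mapping.keys v" for i using assms(1) that by (simp add: homog_def)
  then show ?thesis unfolding lin_ext_def by (intro homog_sum homog_scaleC assms(2))
qed

context quantum_sphere
begin

lemma homog_op:
  assumes "v \<in> homog g"
  shows "La v \<in> homog (g + 1)" "Lb v \<in> homog (g - 1)" "Lc v \<in> homog (g + 1)" "Ld v \<in> homog (g - 1)"
    "Dp v \<in> homog (g - 2)" "Dm v \<in> homog (g + 2)"
proof -
  have m: "qn n = 0 \<or> int (n - Suc 0) = int n - 1" for n by (cases n) auto
  show "La v \<in> homog (g + 1)" "Lb v \<in> homog (g - 1)" "Lc v \<in> homog (g + 1)" "Ld v \<in> homog (g - 1)"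
    "Dp v \<in> homog (g - 2)" "Dm v \<in> homog (g + 2)"
    unfolding op_defs using m
    by (intro homog_lin_ext[OF assms];
        auto simp: grade_def intro!: homog_add homog_single split: prod.splits; force)+
qed

lemma function_word:
  assumes "word_deg w = 0"
  shows "\<exists>v\<in>homog (word_grade w). act_word w vac = (v, 0, 0, 0)"
proof -
  have "\<exists>v\<in>homog (\<Sum>g\<leftarrow>l. gen_grade g). foldr act l vac = (v, 0, 0, 0)"
    if "\<forall>g\<in>set l. g \<notin> {Gep, Gem}" for l
    using that
  proof (induction l)
    case Nil
    show ?case by (auto simp: vac_def intro!: homog_single simp: grade_def)
  next
    case (Cons g l)
    then obtain v where v: "v \<in> homog (\<Sum>g\<leftarrow>l. gen_grade g)" "foldr act l vac = (v, 0, 0, 0)"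
      by auto
    then show ?case
      using homog_op[OF v(1)] Cons.prems by (cases g) (simp_all add: add.commute[of 1] uminus_add_conv_diff)
  qed
  moreover have "\<forall>g\<in>set (letters w). g \<notin> {Gep, Gem}"
    using assms by (auto simp: word_deg_def filter_empty_conv)
  ultimately show ?thesis by (simp add: act_word_def word_grade_def)
qed

abbreviation fn :: "fnspace \<Rightarrow> free set" where "fn v \<equiv> form (v, 0, 0, 0)"

lemma fn_eq_cl: "fn v = cl q (emb v)"
  by (simp add: form_def)

lemma keys_emb: "w \<in> Poly_Mapping.keys (emb v) \<Longrightarrow> \<exists>i\<in>Poly_Mapping.keys v. w = nword i"
proof -
  assume "w \<in> Poly_Mapping.keys (emb v)"
  then have "(\<Sum>i\<in>Poly_Mapping.keys v. lookup v i * lookup (nmon i) w) \<noteq> 0"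
    by (simp add: emb_def lin_ext_def in_keys_iff lookup_sum)
  then obtain i where "i \<in> Poly_Mapping.keys v" "lookup (nmon i) w \<noteq> 0"
    by (metis (no_types, lifting) sum.not_neutral_contains_not_neutral mult_eq_0_iff)
  then show ?thesis by (auto simp: nmon_def lookup_single when_def split: if_splits)
qed

lemma nword_deg: "word_deg (nword i) = 0" and nword_grade: "word_grade (nword i) = grade i"
  by (cases i; simp add: word_deg_def word_grade_def nword_def grade_def sum_list_replicate; linarith)+

lemma rho_function:
  assumes deg: "\<forall>w\<in>Poly_Mapping.keys u. word_deg w = 0"
  obtains v where "rho u vac = (v, 0, 0, 0)"
    "\<And>g. \<forall>w\<in>Poly_Mapping.keys u. word_grade w = g \<Longrightarrow> v \<in> homog g"
proof -
  have "\<exists>v. (\<Sum>w\<in>A. lookup u w *\<^sub>C act_word w vac) = (v, 0, 0, 0) \<and>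
      (\<forall>g. (\<forall>w\<in>Poly_Mapping.keys u. word_grade w = g) \<longrightarrow> v \<in> homog g)"
    if "finite A" "A \<subseteq> Poly_Mapping.keys u" for A
    using that
  proof (induction A)
    case empty
    then show ?case by (auto simp: zero_prod_def)
  next
    case (insert w A)
    then obtain v where v: "(\<Sum>w\<in>A. lookup u w *\<^sub>C act_word w vac) = (v, 0, 0, 0)"
        "\<And>g. (\<forall>w\<in>Poly_Mapping.keys u. word_grade w = g) \<Longrightarrow> v \<in> homog g"
      by blast
    obtain v' where v': "v' \<in> homog (word_grade w)" "act_word w vac = (v', 0, 0, 0)"
      using function_word[of w] deg insert.prems by auto
    have w: "w \<in> Poly_Mapping.keys u" using insert.prems by simp
    show ?case
    proof (intro exI conjI allI impI)
      show "(\<Sum>w\<in>insert w A. lookup u w *\<^sub>C act_word w vac) = (lookup u w *\<^sub>C v' + v, 0, 0, 0)"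
        using insert.hyps v' v(1) by simp
      fix g assume g: "\<forall>w\<in>Poly_Mapping.keys u. word_grade w = g"
      then have "word_grade w = g" using w by blast
      with v'(1) v(2)[OF g] show "lookup u w *\<^sub>C v' + v \<in> homog g"
        by (intro homog_add homog_scaleC) auto
    qed
  qed
  from this[OF finite_keys order.refl] show ?thesis
    using that unfolding rho_def lin_ext_def by blast
qed

lemma CqSL2_grade_eq: "CqSL2_grade q g = fn ` homog g"
proof
  show "CqSL2_grade q g \<subseteq> fn ` homog g"
  proof
    fix X assume "X \<in> CqSL2_grade q g"
    then obtain u where u: "X = cl q u" "\<forall>w\<in>Poly_Mapping.keys u. word_deg w = 0"
        "\<forall>w\<in>Poly_Mapping.keys u. word_grade w = g"
      unfolding CqSL2_grade_def by blast
    from u(2) obtain v where v: "rho u vac = (v, 0, 0, 0)"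
        "\<And>g. \<forall>w\<in>Poly_Mapping.keys u. word_grade w = g \<Longrightarrow> v \<in> homog g"
      using rho_function by blast
    show "X \<in> fn ` homog g" using v(2)[OF u(3)] unfolding u(1) cl_eq_form v(1) by (rule imageI)
  qed
  show "fn ` homog g \<subseteq> CqSL2_grade q g"
  proof
    fix X assume "X \<in> fn ` homog g"
    then obtain v where v: "X = cl q (emb v)" "v \<in> homog g" unfolding fn_eq_cl by blast
    have "word_deg w = 0 \<and> word_grade w = g" if "w \<in> Poly_Mapping.keys (emb v)" for w
      using keys_emb[OF that] v(2) by (auto simp: nword_deg nword_grade homog_def)
    then show "X \<in> CqSL2_grade q g" unfolding v(1) CqSL2_grade_def by (intro imageI CollectI) blast
  qed
qed

lemma CqSL2_eq: "forms q 0 = range fn"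
proof
  show "forms q 0 \<subseteq> range fn"
  proof
    fix X assume "X \<in> forms q 0"
    then obtain u where u: "X = cl q u" "\<forall>w\<in>Poly_Mapping.keys u. word_deg w = 0"
      unfolding forms_def by blast
    from u(2) obtain v where v: "rho u vac = (v, 0, 0, 0)" using rho_function by blast
    show "X \<in> range fn" unfolding u(1) cl_eq_form v by (rule rangeI)
  qed
  show "range fn \<subseteq> forms q 0"
  proof
    fix X assume "X \<in> range fn"
    then obtain v where v: "X = cl q (emb v)" unfolding fn_eq_cl by blast
    have "word_deg w = 0" if "w \<in> Poly_Mapping.keys (emb v)" for w
      using keys_emb[OF that] by (auto simp: nword_deg)
    then show "X \<in> forms q 0" unfolding v forms_def by (intro imageI CollectI) blast
  qed
qed

lemma one_form: "el_ep q \<otimes>\<^bsub>Hq q\<^esub> fn v \<oplus>\<^bsub>Hq q\<^esub> el_em q \<otimes>\<^bsub>Hq q\<^esub> fn w = form (0, v, w, 0)"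
  by (simp add: el_eq form_add)

lemma Omega1_S2_eq: "Omega1_S2 q = {form (0, v, w, 0) | v w. v \<in> homog (- 2) \<and> w \<in> homog 2}"
  unfolding Omega1_S2_def CqSL2_grade_eq
proof (intro equalityI subsetI; elim CollectE exE conjE imageE)
  fix X fp fm v w
  assume "X = el_ep q \<otimes>\<^bsub>Hq q\<^esub> fp \<oplus>\<^bsub>Hq q\<^esub> el_em q \<otimes>\<^bsub>Hq q\<^esub> fm" "fp = fn v" "fm = fn w"
    "v \<in> homog (- 2)" "w \<in> homog 2"
  then show "X \<in> {form (0, v, w, 0) | v w. v \<in> homog (- 2) \<and> w \<in> homog 2}"
    by (auto simp: one_form)
next
  fix X v w
  assume X: "X = form (0, v, w, 0)" "v \<in> homog (- 2)" "w \<in> homog 2"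
  show "X \<in> {el_ep q \<otimes>\<^bsub>Hq q\<^esub> fp \<oplus>\<^bsub>Hq q\<^esub> el_em q \<otimes>\<^bsub>Hq q\<^esub> fm | fp fm.
      fp \<in> fn ` homog (- 2) \<and> fm \<in> fn ` homog 2}"
    unfolding X(1) one_form[symmetric] using X(2,3) by blast
qed

lemma coeff_p_form: "coeff_p q (form (0, v, w, 0)) = fn v"
  unfolding coeff_p_def CqSL2_eq
  by (rule the_equality) (auto simp: one_form intro!: exI[of _ w])

lemma coeff_m_form: "coeff_m q (form (0, v, w, 0)) = fn w"
  unfolding coeff_m_def CqSL2_eq
  by (rule the_equality) (auto simp: one_form intro!: exI[of _ v])

lemma del_form: "del_p q (fn v) = fn (Dp v)" "del_m q (fn v) = fn (Dm v)"
  by (simp_all add: del_p_def del_m_def ext_d_form coeff_p_form coeff_m_form)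

text \<open>
  Since \<open>e\<^sup>+ e\<^sup>- f = q\<^sup>2\<^sup>g f e\<^sup>+ e\<^sup>-\<close> for \<open>f\<close> of grade \<open>g\<close>, multiplying a function from the right by \<open>e\<^sup>+ e\<^sup>-\<close> rescales
  its homogeneous parts.  This is injective, and the identity in grade zero.
\<close>

definition top_twist :: "fnspace \<Rightarrow> fnspace" where
  "top_twist = lin_ext (\<lambda>i. single i (Q powi (- 2 * grade i)))"

lemma lookup_top_twist: "lookup (top_twist v) i = Q powi (- 2 * grade i) * lookup v i"
  by (induction v rule: poly_mapping_linear_induct)
     (auto simp: top_twist_def lin_ext_add lookup_add lookup_single when_def algebra_simps)

lemma top_twist_inj: "top_twist u = top_twist v \<Longrightarrow> u = v"
proof (rule poly_mapping_eqI)
  fix i assume "top_twist u = top_twist v"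
  then have "lookup (top_twist u) i = lookup (top_twist v) i" by simp
  then show "lookup u i = lookup v i" by (simp add: lookup_top_twist)
qed

lemma top_twist_homog: "v \<in> homog 0 \<Longrightarrow> top_twist v = v"
proof (rule poly_mapping_eqI)
  fix i assume "v \<in> homog 0"
  then have "lookup v i = 0 \<or> grade i = 0" by (auto simp: homog_def in_keys_iff)
  then show "lookup (top_twist v) i = lookup v i" by (auto simp: lookup_top_twist)
qed

lemma rho_emb_top: "rho (emb v) (act Gep (act Gem vac)) = (0, 0, 0, top_twist v)"
proof (induction v rule: poly_mapping_linear_induct)
  case (single i c)
  have comm: "act e (rho (nmon i) x) = (Q powi grade i) *\<^sub>C rho (nmon i) (act e x)" if "e \<in> {Gep, Gem}" for e x
    by (rule act_form_rho[OF that]) (simp add: nmon_def nword_deg nword_grade)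
  have "act Gep (act Gem (rho (nmon i) vac)) =
      (Q powi grade i * Q powi grade i) *\<^sub>C rho (nmon i) (act Gep (act Gem vac))"
    by (simp add: comm act_scaleC)
  then have "(Q powi (- 2 * grade i)) *\<^sub>C (act Gep (act Gem (rho (nmon i) vac))) =
      (Q powi (- 2 * grade i) * (Q powi grade i * Q powi grade i)) *\<^sub>C rho (nmon i) (act Gep (act Gem vac))"
    by simp
  also have "Q powi (- 2 * grade i) * (Q powi grade i * Q powi grade i) = 1"
    by (simp add: Q_powi field_simps)
  finally have "rho (nmon i) (act Gep (act Gem vac)) =
      (Q powi (- 2 * grade i)) *\<^sub>C (act Gep (act Gem (rho (nmon i) vac)))"
    by simp
  also have "\<dots> = (0, 0, 0, single i (Q powi (- 2 * grade i)))"
    by (simp add: rho_nmon_vac)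
  finally show ?case
    by (simp add: emb_single rho_scaleC_left top_twist_def del: act.simps)
qed (simp add: emb_add rho_add_left top_twist_def lin_ext_add)

lemma fn_mult_top:
  "fn v \<otimes>\<^bsub>Hq q\<^esub> (el_ep q \<otimes>\<^bsub>Hq q\<^esub> el_em q) = form (0, 0, 0, top_twist v)"
proof -
  have "fn v \<otimes>\<^bsub>Hq q\<^esub> (el_ep q \<otimes>\<^bsub>Hq q\<^esub> el_em q) = cl q (emb v * (var Gep * var Gem))"
    by (simp add: fn_eq_cl cl_mult)
  then show ?thesis by (simp add: cl_eq_form rho_mult rho_emb_top del: act.simps)
qed

lemma coeff_top_form: "t \<in> homog 0 \<Longrightarrow> coeff_top q (form (0, 0, 0, t)) = fn t"
  unfolding coeff_top_def CqSL2_eq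
proof (rule the_equality)
  assume t: "t \<in> homog 0"
  then show "fn t \<in> range fn \<and> form (0, 0, 0, t) = fn t \<otimes>\<^bsub>Hq q\<^esub> (el_ep q \<otimes>\<^bsub>Hq q\<^esub> el_em q)"
    by (simp add: fn_mult_top top_twist_homog)
  fix X assume "X \<in> range fn \<and> form (0, 0, 0, t) = X \<otimes>\<^bsub>Hq q\<^esub> (el_ep q \<otimes>\<^bsub>Hq q\<^esub> el_em q)"
  then obtain v where "X = fn v" "t = top_twist v" by (auto simp: fn_mult_top)
  with top_twist_inj[of t v] top_twist_homog[OF t] show "X = fn t" by simp
qed

section \<open>The Laplacian in coordinates\<close>

lemma codiff_one_form:
  "codiff q \<alpha> \<beta> \<gamma> \<epsilon> 1 (form (0, v, w, 0)) =
     fn (complex_of_real (\<alpha> * q powi (-2)) *\<^sub>C Dm v + complex_of_real (\<beta> * q\<^sup>2) *\<^sub>C Dp w)"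
  by (simp add: codiff_def coeff_p_form coeff_m_form del_form form_smult form_add)

lemma codiff_two_form:
  assumes "t \<in> homog 0"
  shows "codiff q \<alpha> \<beta> \<gamma> \<epsilon> 2 (form (0, 0, 0, t)) =
     form (0, - (complex_of_real (\<beta> * \<epsilon> * q ^ 4) *\<^sub>C Dp t),
       complex_of_real (\<alpha> * \<gamma> * q powi (-4)) *\<^sub>C Dm t, 0)"
  by (simp add: codiff_def coeff_top_form[OF assms] del_form el_eq form_smult form_diff)

text \<open>
  For \<open>\<gamma> = q\<^sup>2\<close> and \<open>\<epsilon> = q\<^sup>-\<^sup>4\<close> the contributions of \<open>\<partial>\<^sub>+ \<partial>\<^sub>+\<close> and \<open>\<partial>\<^sub>- \<partial>\<^sub>-\<close> in \<open>\<delta> d\<close> and \<open>d \<delta>\<close> cancel, so the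
  Laplacian does not mix the two components.
\<close>

lemma Laplacian_one_form:
  fixes \<alpha> \<beta> :: real
  assumes v: "v \<in> homog (- 2)" and w: "w \<in> homog 2"
  defines "c \<equiv> complex_of_real (\<beta> + \<alpha> * q powi (-2))"
  shows "Laplacian q \<alpha> \<beta> (q\<^sup>2) (q powi (-4)) 1 (form (0, v, w, 0)) =
     form (0, c *\<^sub>C Dp (Dm v), c *\<^sub>C Q\<^sup>2 *\<^sub>C Dm (Dp w), 0)"
proof -
  let ?t = "Q\<^sup>2 *\<^sub>C Dp w - Dm v"
  have t: "?t \<in> homog 0"
    using homog_op(5)[OF w] homog_op(6)[OF v] by (auto intro!: homog_diff homog_scaleC)
  have "ext_d q (form (0, v, w, 0)) = form (0, 0, 0, ?t)" by (simp add: ext_d_form)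
  then show ?thesis
    unfolding Laplacian_def
    by (simp add: numeral_2_eq_2[symmetric] codiff_two_form[OF t]
        codiff_one_form[unfolded One_nat_def] ext_d_form form_add)
       (auto intro!: poly_mapping_eqI simp: lookup_add lookup_minus c_def field_simps power_int_minus
          power2_eq_square power4_eq_xxxx)
qed

end

section \<open>Quantum binomials and the eigenvector recurrence\<close>

lemma qint_0 [simp]: "qint q 0 = 0" by (simp add: qint_def)
lemma qint_1 [simp]: "qint q (Suc 0) = 1" by (simp add: qint_def)

lemma qint_Suc: "qint q (Suc n) = qint q n + (q\<^sup>2) ^ n"
  unfolding qint_def sum.lessThan_Suc power_mult ..

lemma qint_geometric: "(q\<^sup>2) ^ n = 1 + (q\<^sup>2 - 1) * qint q n"
proof (induction n)
  case (Suc n)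
  have "(q\<^sup>2) ^ Suc n = (q\<^sup>2) ^ n + (q\<^sup>2 - 1) * (q\<^sup>2) ^ n" by (simp add: algebra_simps)
  with Suc distrib_left[of "q\<^sup>2 - 1" "qint q n" "(q\<^sup>2) ^ n"] show ?case unfolding qint_Suc by linarith
qed simp

lemma qint_add: "qint q (m + n) = qint q m + (q\<^sup>2) ^ m * qint q n"
  by (induction n) (simp_all add: qint_Suc algebra_simps power_add)

lemma qint_pos: "0 < n \<Longrightarrow> 0 < qint q n"
proof (induction n)
  case (Suc n)
  then show ?case by (cases n) (auto simp: qint_Suc intro!: add_pos_nonneg)
qed simp

lemma qfact_Suc: "qfact q (Suc n) = qfact q n * qint q (Suc n)"
  by (simp add: qfact_def)

lemma qfact_nonzero [simp]: "qfact q n \<noteq> 0"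
proof -
  have "qint q i \<noteq> 0" if "i \<in> {1..n}" for i using qint_pos[of i q] that by auto
  then show ?thesis by (simp add: qfact_def)
qed

lemma qbinom_nonzero: "qbinom q n k \<noteq> 0"
  by (simp add: qbinom_def)

lemma qbinom_Suc_right: "r < n \<Longrightarrow> qbinom q n (Suc r) * qint q (Suc r) = qbinom q n r * qint q (n - r)"
proof -
  assume "r < n"
  then obtain d where "n = Suc (r + d)" by (metis less_iff_Suc_add)
  then show ?thesis
    using qint_pos[of "Suc r" q] qint_pos[of "Suc d" q] by (simp add: qbinom_def qfact_Suc Suc_diff_le)
qed

lemma qbinom_Suc_Suc: "qbinom q (Suc n) (Suc k) * qint q (Suc k) = qbinom q n k * qint q (Suc n)"
  using qint_pos[of "Suc k" q] by (simp add: qbinom_def qfact_Suc)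

text \<open>
  With \<open>t = q\<^sup>2\<close> and \<open>[n] = (1 - t\<^sup>n) / (1 - t)\<close> both sides become polynomials in powers of \<open>t\<close>.  To include
  \<open>q = 1\<close> and \<open>q = -1\<close>, the proof instead expresses \<open>t\<^sup>n\<close> by \<open>[n]\<close> and compares polynomials in
  \<open>t\<close>, \<open>[j]\<close> and \<open>[s]\<close>.
\<close>

lemma qint_eigenvalue_gap:
  "qint q (j + s + 1) * qint q (j + s) - (q\<^sup>2) ^ s * (qint q (j + 1) * qint q j)
     = qint q s * qint q (2 * j + s + 1)"
proof -
  define a b t where "a = qint q j" and "b = qint q s" and "t = q\<^sup>2"
  have pow: "t ^ j = 1 + (t - 1) * a" "t ^ s = 1 + (t - 1) * b"
    by (simp_all add: a_def b_def t_def qint_geometric)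
  have 1: "qint q (j + s) = a + t ^ j * b"
    by (simp add: qint_add a_def b_def t_def)
  have 2: "qint q (j + s + 1) = a + t ^ j * b + t ^ j * t ^ s"
    using qint_add[of q "j + s" 1] by (simp add: 1 t_def power_add)
  have 3: "qint q (j + 1) = a + t ^ j"
    by (simp add: qint_Suc a_def t_def)
  have 4: "qint q (2 * j + s + 1) = a + t ^ j * (a + t ^ j * (b + t ^ s))"
    using qint_add[of q j "j + (s + 1)"] qint_add[of q j "s + 1"] qint_add[of q s 1]
    by (simp add: a_def b_def t_def mult_2 add.assoc)
  show ?thesis
    unfolding 1 2 3 4 a_def[symmetric] b_def[symmetric] t_def[symmetric] pow
    by (simp add: algebra_simps)
qed

text \<open>
  All eight families have coefficients and eigenvalues of the same shape.  Here \<open>J\<close> is the least value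
  of \<open>N\<close> for which the eigenvalue \<open>q\<^sup>5\<^sup>-\<^sup>2\<^sup>N [N] [N - 1]\<close> occurs among the forms with a given power of \<open>a\<close> or \<open>d\<close>,
  \<open>K\<close> is the exponent of \<open>b\<close> or \<open>c\<close> in front of the polynomial in \<open>x\<close>, and \<open>w\<close> is twice the power of
  \<open>d\<close>.  Applied to the monomial with factor \<open>x\<^sup>r\<close>, the operator gives that monomial times
  \<open>spin_eigenvalue q (J + r)\<close>, plus the one with factor \<open>x\<^sup>r\<^sup>-\<^sup>1\<close> times \<open>lowering_coeff q J K w r\<close>.
\<close>

definition spin_coeff :: "real \<Rightarrow> nat \<Rightarrow> nat \<Rightarrow> nat \<Rightarrow> nat \<Rightarrow> nat \<Rightarrow> real" where
  "spin_coeff q J K w T r = q ^ ((T - r) * (w + (T - r))) * qbinom q T r * qbinom q (2 * J - 2 + T + r) (K + r)"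

definition spin_eigenvalue :: "real \<Rightarrow> nat \<Rightarrow> real" where
  "spin_eigenvalue q N = q powi (5 - 2 * int N) * qint q N * qint q (N - 1)"

definition lowering_coeff :: "real \<Rightarrow> nat \<Rightarrow> nat \<Rightarrow> nat \<Rightarrow> nat \<Rightarrow> real" where
  "lowering_coeff q J K w r = q powi (6 - 2 * int J + int w - 2 * int r) * qint q r * qint q (K + r)"

text \<open>
  The coefficient equation of the eigenvector problem.  The quotient of consecutive \<open>q\<close>-binomials
  produces \<open>[T - r]\<close> and \<open>[2 J - 1 + T + r]\<close>, whose product is the gap between the eigenvalues; the two
  denominators cancel against the lowering coefficient.
\<close>

lemma spin_coeff_recurrence:
  assumes q: "q \<noteq> 0" and J: "J \<ge> 1" and r: "r < T"
  shows "spin_coeff q J K w T (Suc r) * lowering_coeff q J K w (Suc r) =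
    (spin_eigenvalue q (J + T) - spin_eigenvalue q (J + r)) * spin_coeff q J K w T r"
proof -
  obtain s where T: "T = r + Suc s" using r less_iff_Suc_add by (metis add_Suc_right)
  obtain j where J': "J = Suc j" using J by (cases J) auto
  define B where "B = qbinom q T r * qbinom q (2 * J - 2 + T + r) (K + r)"
  have b1: "qbinom q T (Suc r) * qint q (Suc r) = qbinom q T r * qint q (Suc s)"
    using qbinom_Suc_right[OF r, of q] by (simp add: T)
  have b2: "qbinom q (2 * J - 2 + T + Suc r) (K + Suc r) * qint q (K + Suc r) =
      qbinom q (2 * J - 2 + T + r) (K + r) * qint q (2 * J - 1 + T + r)"
    using qbinom_Suc_Suc[of q "2 * J - 2 + T + r" "K + r"] by (simp add: J')
  define x where "x = q powi (5 - 2 * int J - 2 * int T)"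
  have e1: "q ^ (s * (w + s)) * q powi (6 - 2 * int J + int w - 2 * int (Suc r)) =
      x * q ^ (Suc s * (w + Suc s))"
  proof -
    have "q ^ (s * (w + s)) * q powi (6 - 2 * int J + int w - 2 * int (Suc r)) =
        q powi (int (s * (w + s)) + (6 - 2 * int J + int w - 2 * int (Suc r)))"
      using q by (simp only: power_int_add power_int_of_nat simp_thms)
    also have "int (s * (w + s)) + (6 - 2 * int J + int w - 2 * int (Suc r)) =
       (5 - 2 * int J - 2 * int T) + int (Suc s * (w + Suc s))"
      by (simp add: T algebra_simps)
    also have "q powi \<dots> = x * q ^ (Suc s * (w + Suc s))"
      using q by (simp only: power_int_add power_int_of_nat simp_thms x_def)
    finally show ?thesis .
  qed
  have e2: "q powi (5 - 2 * int (J + r)) = x * (q\<^sup>2) ^ Suc s"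
  proof -
    have "5 - 2 * int (J + r) = (5 - 2 * int J - 2 * int T) + int (2 * Suc s)" by (simp add: T)
    then have "q powi (5 - 2 * int (J + r)) = x * q ^ (2 * Suc s)"
      using q by (simp only: power_int_add power_int_of_nat simp_thms x_def)
    then show ?thesis by (simp only: power_mult)
  qed
  have gap: "spin_eigenvalue q (J + T) - spin_eigenvalue q (J + r) =
      x * (qint q (Suc s) * qint q (2 * J - 1 + T + r))"
  proof -
    have "spin_eigenvalue q (J + T) = x * (qint q ((j + r) + Suc s + 1) * qint q ((j + r) + Suc s))"
      by (simp add: spin_eigenvalue_def x_def J' T algebra_simps)
    moreover have "spin_eigenvalue q (J + r) = x * ((q\<^sup>2) ^ Suc s * (qint q ((j + r) + 1) * qint q (j + r)))"
      unfolding spin_eigenvalue_def e2 by (simp add: J' mult.assoc)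
    moreover have "2 * (j + r) + Suc s + 1 = 2 * J - 1 + T + r" by (simp add: J' T)
    ultimately show ?thesis
      using qint_eigenvalue_gap[of q "j + r" "Suc s"] by (simp only: right_diff_distrib[symmetric])
  qed
  have "spin_coeff q J K w T (Suc r) * lowering_coeff q J K w (Suc r) =
     (q ^ (s * (w + s)) * q powi (6 - 2 * int J + int w - 2 * int (Suc r))) *
     (qbinom q T (Suc r) * qint q (Suc r)) *
     (qbinom q (2 * J - 2 + T + Suc r) (K + Suc r) * qint q (K + Suc r))"
    by (simp add: spin_coeff_def lowering_coeff_def T)
  also have "\<dots> = (x * (qint q (Suc s) * qint q (2 * J - 1 + T + r))) * (q ^ (Suc s * (w + Suc s)) * B)"
    unfolding b1 b2 e1 B_def by (simp only: ac_simps)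
  also have "q ^ (Suc s * (w + Suc s)) * B = spin_coeff q J K w T r"
    by (simp add: spin_coeff_def B_def T)
  finally show ?thesis unfolding gap .
qed

section \<open>Eigenvectors in coordinates\<close>

text \<open>The function \<open>a\<^sup>k b\<^sup>m c\<^sup>p \<Sum>\<^sub>r s\<^sub>r x\<^sup>r\<close>, with \<open>d\<^sup>-\<^sup>k\<close> in place of \<open>a\<^sup>k\<close> if \<open>k < 0\<close>.\<close>

definition row :: "int \<Rightarrow> nat \<Rightarrow> nat \<Rightarrow> nat \<Rightarrow> (nat \<Rightarrow> real) \<Rightarrow> fnspace" where
  "row k m p T s = (\<Sum>r\<le>T. single (k, m + r, p + r) (complex_of_real (s r)))"

lemma row_eigenvector:
  fixes L :: "fnspace \<Rightarrow> fnspace" and lam mu :: "nat \<Rightarrow> real"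
  assumes add: "\<And>u v. L (u + v) = L u + L v"
    and single: "\<And>r c. L (single (k, m + r, p + r) c) =
      single (k, m + r, p + r) (c * complex_of_real (lam r)) +
      single (k, m + r - 1, p + r - 1) (c * complex_of_real (mu r))"
    and mu0: "mu 0 = 0"
    and rec: "\<And>r. r < T \<Longrightarrow> s (Suc r) * mu (Suc r) = (lam T - lam r) * s r"
  shows "L (row k m p T s) = complex_of_real (lam T) *\<^sub>C row k m p T s"
proof -
  let ?e = "\<lambda>r x. single (k, m + r, p + r) (complex_of_real x)"
  have "L (row k m p T s) = (\<Sum>r\<le>T. ?e r (s r * lam r)) +
      (\<Sum>r\<le>T. single (k, m + r - 1, p + r - 1) (complex_of_real (s r * mu r)))"
    unfolding row_def sum_map_additive[of L, OF add] by (simp add: single sum.distrib)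
  also have "(\<Sum>r\<le>T. single (k, m + r - 1, p + r - 1) (complex_of_real (s r * mu r))) =
      (\<Sum>r<T. ?e r (s (Suc r) * mu (Suc r)))"
    by (simp add: sum.atMost_shift mu0)
  also have "\<dots> = (\<Sum>r<T. ?e r ((lam T - lam r) * s r))"
    by (rule sum.cong) (use rec in auto)
  also have "\<dots> = (\<Sum>r\<le>T. ?e r ((lam T - lam r) * s r))"
    by (simp add: lessThan_Suc_atMost[symmetric])
  also have "(\<Sum>r\<le>T. ?e r (s r * lam r)) + \<dots> = (\<Sum>r\<le>T. ?e r (lam T * s r))"
    by (simp add: sum.distrib[symmetric] single_add[symmetric] algebra_simps)
  also have "\<dots> = complex_of_real (lam T) *\<^sub>C row k m p T s"
    by (simp add: row_def scaleC_sum_right)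
  finally show ?thesis .
qed

text \<open>
  Each member of the list is \<open>e\<^sup>+\<close> or \<open>e\<^sup>-\<close> times a power of \<open>a\<close> or \<open>d\<close>, powers of \<open>b\<close> and \<open>c\<close>, and a
  polynomial in \<open>x\<close>; the following tables hold these data.  A negative \<open>ad_power\<close> is a power of \<open>d\<close>.
\<close>

fun is_plus :: "eig_index \<Rightarrow> bool" where
  "is_plus (Eig1 n p) = True" | "is_plus (Eig2 n p) = False"
| "is_plus (Eig3 n m) = True" | "is_plus (Eig4 n m) = False"
| "is_plus (Eig5 p) = True" | "is_plus (Eig6 m) = False"
| "is_plus (Eig7 p) = True" | "is_plus (Eig8 m) = False"

fun ad_power :: "eig_index \<Rightarrow> int" where
  "ad_power (Eig1 n p) = int n" | "ad_power (Eig2 n p) = int n"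
| "ad_power (Eig3 n m) = - int n" | "ad_power (Eig4 n m) = - int n"
| "ad_power (Eig5 p) = 0" | "ad_power (Eig6 m) = 0"
| "ad_power (Eig7 p) = - 1" | "ad_power (Eig8 m) = 1"

fun b_power :: "eig_index \<Rightarrow> nat" where
  "b_power (Eig1 n p) = n + 2" | "b_power (Eig2 n p) = n - 2"
| "b_power (Eig5 p) = 2" | "b_power (Eig7 p) = 1"
| "b_power _ = 0"

fun c_power :: "eig_index \<Rightarrow> nat" where
  "c_power (Eig3 n p) = n - 2" | "c_power (Eig4 n p) = n + 2"
| "c_power (Eig6 p) = 2" | "c_power (Eig8 p) = 1"
| "c_power _ = 0"

fun top_degree :: "eig_index \<Rightarrow> nat" where
  "top_degree (Eig1 n p) = p" | "top_degree (Eig2 n p) = p"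
| "top_degree (Eig3 n m) = m" | "top_degree (Eig4 n m) = m"
| "top_degree (Eig5 p) = p" | "top_degree (Eig6 m) = m"
| "top_degree (Eig7 p) = p" | "top_degree (Eig8 m) = m"

fun least_spin :: "eig_index \<Rightarrow> nat" where
  "least_spin (Eig1 n p) = n + 2" | "least_spin (Eig2 n p) = n"
| "least_spin (Eig3 n m) = n" | "least_spin (Eig4 n m) = n + 2"
| "least_spin _ = 2"

definition coeffs :: "real \<Rightarrow> eig_index \<Rightarrow> nat \<Rightarrow> real" where
  "coeffs q i = spin_coeff q (least_spin i) (b_power i + c_power i) (2 * nat (- ad_power i)) (top_degree i)"

definition lowering :: "real \<Rightarrow> eig_index \<Rightarrow> nat \<Rightarrow> real" where
  "lowering q i = lowering_coeff q (least_spin i) (b_power i + c_power i) (2 * nat (- ad_power i))"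

lemma coeffs_recurrence:
  assumes "q \<noteq> 0" "in_list i" "r < top_degree i"
  shows "coeffs q i (Suc r) * lowering q i (Suc r) =
    (spin_eigenvalue q (least_spin i + top_degree i) - spin_eigenvalue q (least_spin i + r)) * coeffs q i r"
  unfolding coeffs_def lowering_def
  by (rule spin_coeff_recurrence) (use assms in \<open>cases i; auto\<close>)+

definition eigen_row :: "real \<Rightarrow> eig_index \<Rightarrow> fnspace" where
  "eigen_row q i = row (ad_power i) (b_power i) (c_power i) (top_degree i) (coeffs q i)"

definition eigen_coords :: "real \<Rightarrow> eig_index \<Rightarrow> formspace" where
  "eigen_coords q i = (if is_plus i then (0, eigen_row q i, 0, 0) else (0, 0, eigen_row q i, 0))"

lemma eigenvalue_eq:
  "in_list i \<Longrightarrow> eigenvalue q \<alpha> \<beta> i =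
     (\<beta> + \<alpha> * q powi (-2)) * spin_eigenvalue q (least_spin i + top_degree i)"
  by (cases i) (auto simp: spin_eigenvalue_def algebra_simps)

context quantum_sphere
begin

lemma qn_eq: "qn n = complex_of_real (qint q n)"
  by (simp add: qn_def qint_def)

lemma minus_one_minus: "- 1 - int n = - int n - 1"
  by simp

text \<open>
  On a monomial one of the two derivatives has one term and the other, applied after it or before it, has
  two; which of them depends on whether the monomial contains \<open>a\<close> or \<open>d\<close>.
\<close>

lemma Dp_Dm_single_nonneg:
  assumes "k \<ge> 0"
  shows "Dp (Dm (single (k, m, p) c)) =
    single (k, m, p) (c * complex_of_real (q powi (1 - 2 * k - 2 * int p) * qint q m * qint q (nat k + p + 1))) +
    single (k, m - 1, p - 1) (c * complex_of_real (q powi (2 - 2 * k - 2 * int p) * qint q m * qint q p))"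
  using assms
  by (cases m; cases p; cases k rule: sign_cases; hypsubst; (rule poly_mapping_eqI)?;
      (simp add: op_simps minus_one_minus flip: qn_eq)?;
      auto simp: coefficient_simps field_simps minus_one_minus eval_nat_numeral)

lemma Dp_Dm_single_neg:
  assumes "k < 0"
  shows "Dp (Dm (single (k, m, p) c)) =
    single (k, m, p) (c * complex_of_real (q powi (1 - 2 * int p) * qint q (m + nat (- k)) * qint q (p + 1))) +
    single (k, m - 1, p - 1) (c * complex_of_real (q powi (2 - 2 * k - 2 * int p) * qint q m * qint q p))"
  using assms
  by (cases m; cases p; cases k rule: sign_cases; hypsubst; (rule poly_mapping_eqI)?;
      (simp add: op_simps minus_one_minus flip: qn_eq)?;
      auto simp: coefficient_simps field_simps minus_one_minus eval_nat_numeral)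

lemma Dm_Dp_single_nonpos:
  assumes "k \<le> 0"
  shows "Q\<^sup>2 *\<^sub>C Dm (Dp (single (k, m, p) c)) =
    single (k, m, p) (c * complex_of_real (q powi (5 - 2 * int p) * qint q p * qint q (m + nat (- k) + 1))) +
    single (k, m - 1, p - 1) (c * complex_of_real (q powi (6 - 2 * k - 2 * int p) * qint q p * qint q m))"
  using assms
  by (cases m; cases p; cases k rule: sign_cases; hypsubst; (rule poly_mapping_eqI)?;
      (simp add: op_simps minus_one_minus flip: qn_eq)?;
      auto simp: coefficient_simps field_simps minus_one_minus eval_nat_numeral)

lemma Dm_Dp_single_pos:
  assumes "k > 0"
  shows "Q\<^sup>2 *\<^sub>C Dm (Dp (single (k, m, p) c)) =
    single (k, m, p) (c * complex_of_real (q powi (5 - 2 * k - 2 * int p) * qint q (nat k + p) * qint q (m + 1))) +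
    single (k, m - 1, p - 1) (c * complex_of_real (q powi (6 - 2 * k - 2 * int p) * qint q p * qint q m))"
  using assms
  by (cases m; cases p; cases k rule: sign_cases; hypsubst; (rule poly_mapping_eqI)?;
      (simp add: op_simps minus_one_minus flip: qn_eq)?;
      auto simp: coefficient_simps field_simps minus_one_minus eval_nat_numeral)

lemma eigen_row_plus:
  assumes "in_list i" "is_plus i"
  shows "Dp (Dm (eigen_row q i)) =
    complex_of_real (spin_eigenvalue q (least_spin i + top_degree i)) *\<^sub>C eigen_row q i"
  unfolding eigen_row_def
proof (rule row_eigenvector[where lam = "\<lambda>r. spin_eigenvalue q (least_spin i + r)" and mu = "lowering q i"])
  show "Dp (Dm (u + v)) = Dp (Dm u) + Dp (Dm v)" for u v
    by (simp add: scaleC_add_right)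
  show "Dp (Dm (single (ad_power i, b_power i + r, c_power i + r) c)) =
    single (ad_power i, b_power i + r, c_power i + r)
      (c * complex_of_real (spin_eigenvalue q (least_spin i + r))) +
    single (ad_power i, b_power i + r - 1, c_power i + r - 1) (c * complex_of_real (lowering q i r))" for r c
    using assms
    by (cases i) (auto simp: Dp_Dm_single_nonneg Dp_Dm_single_neg spin_eigenvalue_def lowering_def
        lowering_coeff_def algebra_simps dest!: le_Suc_ex)
qed (use assms coeffs_recurrence in \<open>simp_all add: lowering_def lowering_coeff_def\<close>)

lemma eigen_row_minus:
  assumes "in_list i" "\<not> is_plus i"
  shows "Q\<^sup>2 *\<^sub>C Dm (Dp (eigen_row q i)) =
    complex_of_real (spin_eigenvalue q (least_spin i + top_degree i)) *\<^sub>C eigen_row q i"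
  unfolding eigen_row_def
proof (rule row_eigenvector[where lam = "\<lambda>r. spin_eigenvalue q (least_spin i + r)" and mu = "lowering q i"])
  show "Q\<^sup>2 *\<^sub>C Dm (Dp (u + v)) = Q\<^sup>2 *\<^sub>C Dm (Dp u) + Q\<^sup>2 *\<^sub>C Dm (Dp v)" for u v
    by (simp add: scaleC_add_right)
  show "Q\<^sup>2 *\<^sub>C Dm (Dp (single (ad_power i, b_power i + r, c_power i + r) c)) =
    single (ad_power i, b_power i + r, c_power i + r)
      (c * complex_of_real (spin_eigenvalue q (least_spin i + r))) +
    single (ad_power i, b_power i + r - 1, c_power i + r - 1) (c * complex_of_real (lowering q i r))" for r c
    using assms
    by (cases i) (auto simp: Dm_Dp_single_nonpos Dm_Dp_single_pos spin_eigenvalue_def lowering_def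
        lowering_coeff_def algebra_simps dest!: le_Suc_ex)
qed (use assms coeffs_recurrence in \<open>simp_all add: lowering_def lowering_coeff_def\<close>)

end

section \<open>Triangular families are bases\<close>

text \<open>
  A family \<open>v\<close> is a basis if the functionals \<open>\<phi> i\<close> separate points, have finite support on each vector, and
  form with \<open>v\<close> a triangular matrix with nonzero diagonal for the height \<open>h\<close>.  A vector is expanded by
  clearing its coordinates from the greatest height downwards; a linear relation is refuted by a member of
  greatest height in it.
\<close>

lemma triangular_basis:
  fixes v :: "'i \<Rightarrow> 'v::cvec" and \<phi> :: "'i \<Rightarrow> 'v \<Rightarrow> complex" and h :: "'i \<Rightarrow> nat"
  assumes \<phi>_add: "\<And>i x y. \<phi> i (x + y) = \<phi> i x + \<phi> i y"
    and \<phi>_scale: "\<And>i z x. \<phi> i (z *\<^sub>C x) = z * \<phi> i x"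
    and diag: "\<And>i. i \<in> I \<Longrightarrow> \<phi> i (v i) \<noteq> 0"
    and below: "\<And>i j. i \<in> I \<Longrightarrow> j \<in> I \<Longrightarrow> \<phi> j (v i) \<noteq> 0 \<Longrightarrow> j = i \<or> h j < h i"
    and V_add: "\<And>x y. x \<in> V \<Longrightarrow> y \<in> V \<Longrightarrow> x + y \<in> V"
    and V_scale: "\<And>z x. x \<in> V \<Longrightarrow> z *\<^sub>C x \<in> V"
    and v_V: "\<And>i. i \<in> I \<Longrightarrow> v i \<in> V"
    and finite: "\<And>x. x \<in> V \<Longrightarrow> finite {i \<in> I. \<phi> i x \<noteq> 0}"
    and separating: "\<And>x. x \<in> V \<Longrightarrow> (\<And>i. i \<in> I \<Longrightarrow> \<phi> i x = 0) \<Longrightarrow> x = 0"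
    and x: "x \<in> V"
  shows "\<exists>!c. Poly_Mapping.keys c \<subseteq> I \<and> x = lin_ext v c"
proof -
  have V_sum: "(\<Sum>i\<in>A. z i *\<^sub>C v i) \<in> V" if "A \<subseteq> I" for A z
    using that V_scale[OF x, of 0]
    by (induction A rule: infinite_finite_induct) (auto intro!: V_add V_scale v_V)
  have \<phi>_sum: "\<phi> j (\<Sum>i\<in>A. z i *\<^sub>C v i) = (\<Sum>i\<in>A. z i * \<phi> j (v i))" for j A z
  proof -
    have "\<phi> j 0 = 0" using \<phi>_scale[of j 0 0] by simp
    then show ?thesis by (induction A rule: infinite_finite_induct) (auto simp: \<phi>_add \<phi>_scale)
  qed
  have ex: "\<exists>c. Poly_Mapping.keys c \<subseteq> I \<and> x = lin_ext v c"
    if "x \<in> V" "\<And>i. i \<in> I \<Longrightarrow> \<phi> i x \<noteq> 0 \<Longrightarrow> h i < n" for n x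
    using that
  proof (induction n arbitrary: x)
    case 0
    then have "x = 0" using separating by blast
    then show ?case by (intro exI[of _ 0]) simp
  next
    case (Suc n)
    \<comment> \<open>Subtracting multiples of the members of height \<open>n\<close> clears the coordinates of that height.\<close>
    define A where "A = {i \<in> I. \<phi> i x \<noteq> 0 \<and> h i = n}"
    define z where "z = (\<lambda>i. \<phi> i x / \<phi> i (v i))"
    define y where "y = x + (- 1) *\<^sub>C (\<Sum>i\<in>A. z i *\<^sub>C v i)"
    have A: "A \<subseteq> I" "finite A"
      using finite[OF Suc.prems(1)] by (auto simp: A_def intro: rev_finite_subset)
    have y: "y \<in> V" unfolding y_def by (intro V_add V_scale V_sum Suc.prems A)
    have "h j < n" if j: "j \<in> I" "\<phi> j y \<noteq> 0" for j
    proof (rule ccontr)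
      assume hj: "\<not> h j < n"
      have off: "\<phi> j (v i) = 0" if "i \<in> A" "i \<noteq> j" for i
        using below[of i j] that j A hj by (auto simp: A_def)
      have "\<phi> j (\<Sum>i\<in>A. z i *\<^sub>C v i) = (\<Sum>i\<in>A. if i = j then \<phi> j x else 0)"
        unfolding \<phi>_sum by (rule sum.cong) (auto simp: off z_def diag[OF j(1)])
      also have "\<dots> = \<phi> j x"
      proof -
        have "j \<in> A" if "\<phi> j x \<noteq> 0"
          using Suc.prems(2)[OF j(1) that] hj j(1) that by (simp add: A_def)
        then show ?thesis using A(2) by (cases "j \<in> A") auto
      qed
      finally show False using j(2) by (simp add: y_def \<phi>_add \<phi>_scale)
    qed
    from Suc.IH[OF y this] obtain c where c: "Poly_Mapping.keys c \<subseteq> I" "y = lin_ext v c" by blast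
    define d where "d = (\<Sum>i\<in>A. single i (z i))"
    have d: "lin_ext v d = (\<Sum>i\<in>A. z i *\<^sub>C v i)"
      unfolding d_def by (subst sum_map_additive[of "lin_ext v", OF lin_ext_add]) simp
    have "Poly_Mapping.keys d \<subseteq> I"
      unfolding d_def using A(2,1)
      by (induction A) (auto dest!: subsetD[OF Poly_Mapping.keys_add] split: if_splits)
    then have "Poly_Mapping.keys (c + d) \<subseteq> I"
      using c(1) Poly_Mapping.keys_add[of c d] by blast
    moreover have "x = lin_ext v (c + d)"
      by (simp add: lin_ext_add d c(2)[symmetric] y_def scaleC_minus_left)
    ultimately show ?case by blast
  qed
  have "\<exists>n. \<forall>i\<in>I. \<phi> i x \<noteq> 0 \<longrightarrow> h i < n"
  proof -
    have "finite (h ` {i \<in> I. \<phi> i x \<noteq> 0})" using finite[OF x] by simp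
    then obtain n where "\<forall>k\<in>h ` {i \<in> I. \<phi> i x \<noteq> 0}. k < n"
      using finite_nat_set_iff_bounded by blast
    then show ?thesis by blast
  qed
  then have existence: "\<exists>c. Poly_Mapping.keys c \<subseteq> I \<and> x = lin_ext v c"
    using ex[OF x] by blast
  have independent: "c = 0" if c: "Poly_Mapping.keys c \<subseteq> I" "lin_ext v c = 0" for c
  proof (rule ccontr)
    assume "c \<noteq> 0"
    then have "Poly_Mapping.keys c \<noteq> {}" by simp
    then obtain i where i: "i \<in> Poly_Mapping.keys c" "\<And>j. j \<in> Poly_Mapping.keys c \<Longrightarrow> h j \<le> h i"
      using obtains_MAX[of "Poly_Mapping.keys c" h] by (metis finite_keys Max_ge finite_imageI imageI)
    have "lookup c j * \<phi> i (v j) = (if j = i then lookup c i * \<phi> i (v i) else 0)"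
      if "j \<in> Poly_Mapping.keys c" for j
      using below[of j i] i that c(1) by (force simp: not_less)
    then have "\<phi> i (lin_ext v c) =
        (\<Sum>j\<in>Poly_Mapping.keys c. if j = i then lookup c i * \<phi> i (v i) else 0)"
      unfolding lin_ext_def \<phi>_sum by (rule sum.cong[OF refl])
    also have "\<dots> = lookup c i * \<phi> i (v i)" using i(1) by simp
    finally have "\<phi> i (lin_ext v c) = lookup c i * \<phi> i (v i)" .
    moreover have "\<phi> i (lin_ext v c) = 0" using \<phi>_scale[of i 0 0] c(2) by simp
    ultimately show False using i(1) diag[of i] c(1) by (auto simp: in_keys_iff)
  qed
  show ?thesis
  proof (rule ex_ex1I[OF existence])
    fix c d assume c: "Poly_Mapping.keys c \<subseteq> I \<and> x = lin_ext v c"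
      and d: "Poly_Mapping.keys d \<subseteq> I \<and> x = lin_ext v d"
    from c d have eq: "lin_ext v c = lin_ext v d" by metis
    have "lin_ext v (c - d) = 0" by (simp add: lin_ext_diff eq)
    moreover have "Poly_Mapping.keys (c - d) \<subseteq> I"
      using c d keys_diff[of c d] by blast
    ultimately have "c - d = 0" using independent by blast
    then show "c = d" by simp
  qed
qed

section \<open>The eigenforms\<close>

lemma row_cong:
  "k = k' \<Longrightarrow> m = m' \<Longrightarrow> p = p' \<Longrightarrow> (\<And>r. r \<le> T \<Longrightarrow> s r = t r) \<Longrightarrow> row k m p T s = row k' m' p' T t"
  unfolding row_def by (auto intro: sum.cong)

lemma coeffs_top: "in_list i \<Longrightarrow> coeffs q i (top_degree i) \<noteq> 0"
  by (simp add: coeffs_def spin_coeff_def qbinom_nonzero)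

lemma lookup_row:
  assumes "r \<le> T"
  shows "lookup (row k m p T s) (k, m + r, p + r) = complex_of_real (s r)"
proof -
  have "lookup (row k m p T s) (k, m + r, p + r) = (\<Sum>i\<le>T. if i = r then complex_of_real (s r) else 0)"
    unfolding row_def lookup_sum by (rule sum.cong[OF refl]) (simp add: lookup_single)
  then show ?thesis using assms by simp
qed

lemma lookup_row_nonzero:
  assumes "lookup (row k m p T s) j \<noteq> 0"
  obtains r where "r \<le> T" "j = (k, m + r, p + r)"
proof -
  have "(\<Sum>r\<le>T. lookup (single (k, m + r, p + r) (complex_of_real (s r))) j) \<noteq> 0"
    using assms by (simp add: row_def lookup_sum)
  then obtain r where "r \<in> {..T}" "lookup (single (k, m + r, p + r) (complex_of_real (s r))) j \<noteq> 0"
    by (rule sum.not_neutral_contains_not_neutral)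
  then show ?thesis using that by (auto simp: lookup_single when_def split: if_splits)
qed

text \<open>The component and the basis monomial of the term of an eigenform that has the highest power of \<open>x\<close>.\<close>

definition leading :: "eig_index \<Rightarrow> bool \<times> int \<times> nat \<times> nat" where
  "leading i = (is_plus i, ad_power i, b_power i + top_degree i, c_power i + top_degree i)"

text \<open>
  Conversely, a basis monomial of the right grade determines the eigenform that it leads, so the list misses
  no monomial.
\<close>

fun index_of :: "bool \<times> int \<times> nat \<times> nat \<Rightarrow> eig_index" where
  "index_of (True, k, m, p) =
     (if k \<ge> 1 then Eig1 (nat k) p else if k = 0 then Eig5 p
      else if k = - 1 then Eig7 p else Eig3 (nat (- k)) m)"
| "index_of (False, k, m, p) =
     (if k \<ge> 2 then Eig2 (nat k) p else if k = 1 then Eig8 m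
      else if k = 0 then Eig6 m else Eig4 (nat (- k)) m)"

definition form_grade :: "bool \<Rightarrow> int" where "form_grade b = (if b then - 2 else 2)"

lemma index_of_leading: "in_list i \<Longrightarrow> index_of (leading i) = i"
  by (cases i) (auto simp: leading_def)

lemma leading_index_of:
  assumes "grade j = form_grade b"
  shows "in_list (index_of (b, j))" "leading (index_of (b, j)) = (b, j)"
  using assms by (cases j; cases b; auto simp: leading_def grade_def form_grade_def split: if_splits; linarith)+

lemma grade_row:
  assumes "in_list i"
  shows "grade (ad_power i, b_power i + r, c_power i + r) = form_grade (is_plus i)"
  using assms by (cases i) (auto simp: grade_def form_grade_def)

text \<open>
  Every term of an eigenform is the leading term of some eigenform in the same family with a lower or equal
  degree in \<open>x\<close>: this makes the matrix triangular.
\<close>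

lemma leading_row:
  assumes "in_list i" "r \<le> top_degree i" "in_list j"
    and "leading j = (is_plus i, ad_power i, b_power i + r, c_power i + r)"
  shows "j = i \<and> r = top_degree i \<or> top_degree j < top_degree i"
proof -
  have "j = index_of (is_plus i, ad_power i, b_power i + r, c_power i + r)"
    using index_of_leading[OF assms(3)] assms(4) by simp
  then show ?thesis using assms(1,2) by (cases i) auto
qed

lemma eigen_row_homog: "in_list i \<Longrightarrow> eigen_row q i \<in> homog (form_grade (is_plus i))"
  unfolding eigen_row_def row_def by (intro homog_sum homog_single disjI2 grade_row)

fun coord :: "bool \<times> int \<times> nat \<times> nat \<Rightarrow> formspace \<Rightarrow> complex" where
  "coord (b, j) (u, v, w, t) = lookup (if b then v else w) j"

lemma coord_eigen:
  "coord (b, j) (eigen_coords q i) = (if b = is_plus i then lookup (eigen_row q i) j else 0)"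
  by (simp add: eigen_coords_def)

lemma coord_leading:
  assumes "in_list i"
  shows "coord (leading i) (eigen_coords q i) \<noteq> 0"
  using coeffs_top[OF assms, of q] by (simp add: leading_def coord_eigen eigen_row_def lookup_row)

lemma coord_below:
  assumes "in_list i" "in_list j" "coord (leading j) (eigen_coords q i) \<noteq> 0"
  shows "j = i \<or> top_degree j < top_degree i"
proof -
  obtain b k m p where l: "leading j = (b, k, m, p)" by (cases "leading j")
  have b: "b = is_plus i" and nz: "lookup (eigen_row q i) (k, m, p) \<noteq> 0"
    using assms(3) unfolding l coord_eigen by (auto split: if_splits)
  from nz show ?thesis
    unfolding eigen_row_def
  proof (rule lookup_row_nonzero)
    fix r assume "r \<le> top_degree i" "(k, m, p) = (ad_power i, b_power i + r, c_power i + r)"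
    then show ?thesis using leading_row[OF assms(1) _ assms(2), of r] l b by blast
  qed
qed

definition one_forms :: "formspace set" where
  "one_forms = {(0, v, w, 0) | v w. v \<in> homog (- 2) \<and> w \<in> homog 2}"

lemma eigen_coords_one_form: "in_list i \<Longrightarrow> eigen_coords q i \<in> one_forms"
  using eigen_row_homog[of i q] by (auto simp: eigen_coords_def one_forms_def form_grade_def)

text \<open>The monomial basis of the one-forms, labelled by the eigenforms that its members lead.\<close>

lemma eigen_coords_basis:
  assumes "x \<in> one_forms"
  shows "\<exists>!c. Poly_Mapping.keys c \<subseteq> {i. in_list i} \<and> x = lin_ext (eigen_coords q) c"
proof (rule triangular_basis[where \<phi> = "\<lambda>i. coord (leading i)" and h = top_degree and V = one_forms])
  show "coord (leading i) (x + y) = coord (leading i) x + coord (leading i) y" for i x y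
    by (cases x; cases y; cases "leading i") (simp add: lookup_add)
  show "coord (leading i) (z *\<^sub>C x) = z * coord (leading i) x" for i z x
    by (cases x; cases "leading i") simp
  show "finite {i \<in> {i. in_list i}. coord (leading i) x \<noteq> 0}" if "x \<in> one_forms" for x
  proof -
    obtain v w where x: "x = (0, v, w, 0)" using \<open>x \<in> one_forms\<close> by (auto simp: one_forms_def)
    have "leading i \<in> Pair True ` Poly_Mapping.keys v \<union> Pair False ` Poly_Mapping.keys w"
      if "coord (leading i) x \<noteq> 0" for i
      using that unfolding x by (cases "leading i") (auto simp: in_keys_iff split: if_splits)
    then have "leading ` {i \<in> {i. in_list i}. coord (leading i) x \<noteq> 0} \<subseteq>
        Pair True ` Poly_Mapping.keys v \<union> Pair False ` Poly_Mapping.keys w" by blast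
    then have "finite (leading ` {i \<in> {i. in_list i}. coord (leading i) x \<noteq> 0})"
      by (rule finite_subset) simp
    moreover have "inj_on leading {i \<in> {i. in_list i}. coord (leading i) x \<noteq> 0}"
      by (rule inj_on_inverseI[of _ index_of]) (simp add: index_of_leading)
    ultimately show ?thesis by (rule finite_imageD)
  qed
  show "x = 0" if x: "x \<in> one_forms" "\<And>i. i \<in> {i. in_list i} \<Longrightarrow> coord (leading i) x = 0" for x
  proof -
    obtain v w where vw: "x = (0, v, w, 0)" "v \<in> homog (- 2)" "w \<in> homog 2"
      using x(1) by (auto simp: one_forms_def)
    have zero: "coord (b, j) x = 0" if "grade j = form_grade b" for b j
      using x(2)[of "index_of (b, j)"] leading_index_of[OF that] by simp
    have "lookup v j = 0" for j
      using zero[of j True] vw by (cases "j \<in> Poly_Mapping.keys v") (auto simp: homog_def form_grade_def in_keys_iff)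
    moreover have "lookup w j = 0" for j
      using zero[of j False] vw by (cases "j \<in> Poly_Mapping.keys w") (auto simp: homog_def form_grade_def in_keys_iff)
    ultimately have "v = 0" "w = 0" by (auto intro!: poly_mapping_eqI)
    then show ?thesis by (simp add: vw zero_prod_def)
  qed
  show "x + y \<in> one_forms" if "x \<in> one_forms" "y \<in> one_forms" for x y
    using that by (auto simp: one_forms_def intro!: homog_add)
  show "z *\<^sub>C x \<in> one_forms" if "x \<in> one_forms" for z x
    using that by (auto simp: one_forms_def intro!: homog_scaleC)
qed (use assms coord_leading coord_below eigen_coords_one_form in auto)

context quantum_sphere
begin

lemma finsum_cl: "finite A \<Longrightarrow> (\<Oplus>\<^bsub>Hq q\<^esub>i\<in>A. cl q (f i)) = cl q (sum f A)"
proof (induction A rule: finite_induct)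
  interpret ring "Hq q" by (rule ring_Hq)
  case empty
  then show ?case by (simp add: cl_zero)
next
  interpret ring "Hq q" by (rule ring_Hq)
  case (insert i A)
  then show ?case by (simp add: finsum_insert cl_add Pi_def)
qed

lemma cl_power: "cl q u [^]\<^bsub>Hq q\<^esub> (n::nat) = cl q (u ^ n)"
proof -
  interpret ring "Hq q" by (rule ring_Hq)
  show ?thesis by (induction n) (simp_all add: cl_one cl_mult power_Suc2 del: power_Suc)
qed

lemma xpoly_eq:
  "xpoly q p s = cl q (\<Sum>r\<le>p. complex_of_real (s r) *\<^sub>C (var Gb * var Gc) ^ r)"
  by (simp add: xpoly_def cl_mult cl_power cl_smult finsum_cl)

lemma fn_sum: "(sum f A, 0, 0, 0) = (\<Sum>i\<in>A. (f i, 0, 0, 0) :: formspace)"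
  by (rule sum_map_additive[of "\<lambda>v. (v, 0, 0, 0)"]) simp

lemma rho_row:
  assumes "\<And>r c. rho u (single (k, m + r, p + r) c, 0, 0, 0) = (single (k', m' + r, p' + r) c, 0, 0, 0)"
  shows "rho u (row k m p T s, 0, 0, 0) = (row k' m' p' T s, 0, 0, 0)"
proof -
  show ?thesis
    unfolding row_def fn_sum sum_map_additive[of "rho u", OF rho_add_right] assms ..
qed

lemma rho_x_power: "rho ((var Gb * var Gc) ^ r) vac = (single (0, r, r) 1, 0, 0, 0)"
  by (induction r) (simp_all add: rho_mult Lb_single Lc_single vac_def)

lemma rho_xpoly:
  "rho (\<Sum>r\<le>p. complex_of_real (s r) *\<^sub>C (var Gb * var Gc) ^ r) vac = (row 0 0 0 p s, 0, 0, 0)"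
proof -
  have "rho (\<Sum>r\<le>p. complex_of_real (s r) *\<^sub>C (var Gb * var Gc) ^ r) vac
      = (\<Sum>r\<le>p. (single (0, r, r) (complex_of_real (s r)), 0, 0, 0))"
    by (subst sum_map_additive[of "\<lambda>u. rho u vac", OF rho_add_left])
       (simp add: rho_scaleC_left rho_x_power)
  also have "\<dots> = (row 0 0 0 p s, 0, 0, 0)"
    by (simp add: row_def fn_sum)
  finally show ?thesis .
qed

lemma rho_power_row:
  "rho (var Gb ^ n) (row 0 m p T s, 0, 0, 0) = (row 0 (m + n) p T s, 0, 0, 0)"
  "rho (var Gc ^ n) (row 0 m p T s, 0, 0, 0) = (row 0 m (p + n) T s, 0, 0, 0)"
  "rho (var Ga ^ n) (row 0 m p T s, 0, 0, 0) = (row (int n) m p T s, 0, 0, 0)"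
  "rho (var Gd ^ n) (row 0 m p T s, 0, 0, 0) = (row (- int n) m p T s, 0, 0, 0)"
  by (intro rho_row; simp add: rho_b_power rho_c_power rho_a_power rho_d_power add.commute add.left_commute)+

lemma single_action_row:
  "Lb (row 0 m p T s) = row 0 (Suc m) p T s" "Lc (row 0 m p T s) = row 0 m (Suc p) T s"
  "La (row 0 m p T s) = row 1 m p T s" "Ld (row 0 m p T s) = row (- 1) m p T s"
  using rho_power_row[of 1 m p T s] by simp_all

text \<open>
  The powers of \<open>b\<close> or \<open>c\<close> act first, on monomials without \<open>a\<close> and \<open>d\<close>, and the power of \<open>a\<close> or \<open>d\<close> after
  them; in this order no commutation factors arise.
\<close>

lemma eigenform_eq:
  assumes "in_list i"
  shows "eigenform q i = form (eigen_coords q i)"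
proof -
  have two: "\<exists>k. n = k + 2" if "2 \<le> n" for n :: nat using that by presburger
  note product = eigenform.simps cl_power xpoly_eq cl_mult
  note actions = cl_eq_form rho_mult rho_xpoly rho_power_row
  note generators = rho_var act.simps single_action_row op_zero scaleC_zero_right
  note coordinates = eigen_coords_def is_plus.simps if_True if_False eigen_row_def top_degree.simps
  note coefficients = coeffs_def spin_coeff_def least_spin.simps b_power.simps c_power.simps
    ad_power.simps top_degree.simps
  have plus: "form (0, u, 0, 0) = form (0, v, 0, 0)" and minus: "form (0, 0, u, 0) = form (0, 0, v, 0)"
    if "u = v" for u v using that by simp_all
  note parameters = arg_cong2[where f = "(*)"] arg_cong2[where f = "qbinom q"] arg_cong[where f = "(^) q"]
  have nat_neg: "nat (- int n) = 0" "nat (- (- int n)) = n" "nat (- 0) = 0" "nat (- 1) = 0" "nat (- (- 1)) = 1"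
    for n by simp_all
  note square = power2_eq_square nat_neg mult_0_right add_0
  show ?thesis
  proof (cases i)
    case (Eig1 n p)
    show ?thesis
      unfolding Eig1 product unfolding actions unfolding generators unfolding coordinates
      by (rule plus, rule row_cong; unfold coefficients; (intro parameters refl)?;
          (simp only: square; fail)?; arith?)
  next
    case (Eig2 n p)
    then obtain k where n: "n = k + 2" using assms two by auto
    show ?thesis
      unfolding Eig2 n product unfolding actions unfolding generators unfolding coordinates
      by (rule minus, rule row_cong; unfold coefficients; (intro parameters refl)?;
          (simp only: square; fail)?; arith?)
  next
    case (Eig3 n p)
    then obtain k where n: "n = k + 2" using assms two by auto
    show ?thesis
      unfolding Eig3 n product unfolding actions unfolding generators unfolding coordinates
      by (rule plus, rule row_cong; unfold coefficients; (intro parameters refl)?;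
          (simp only: square; fail)?; arith?)
  next
    case (Eig4 n p)
    show ?thesis
      unfolding Eig4 product unfolding actions unfolding generators unfolding coordinates
      by (rule minus, rule row_cong; unfold coefficients; (intro parameters refl)?;
          (simp only: square; fail)?; arith?)
  next
    case (Eig5 p)
    show ?thesis
      unfolding Eig5 product unfolding actions unfolding generators unfolding coordinates
      by (rule plus, rule row_cong; unfold coefficients; (intro parameters refl)?;
          (simp only: square; fail)?; arith?)
  next
    case (Eig6 p)
    show ?thesis
      unfolding Eig6 product unfolding actions unfolding generators unfolding coordinates
      by (rule minus, rule row_cong; unfold coefficients; (intro parameters refl)?;
          (simp only: square; fail)?; arith?)
  next
    case (Eig7 p)
    show ?thesis
      unfolding Eig7 product unfolding actions unfolding generators unfolding coordinates
      by (rule plus, rule row_cong; unfold coefficients; (intro parameters refl)?;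
          (simp only: square; fail)?; arith?)
  next
    case (Eig8 p)
    show ?thesis
      unfolding Eig8 product unfolding actions unfolding generators unfolding coordinates
      by (rule minus, rule row_cong; unfold coefficients; (intro parameters refl)?;
          (simp only: square; fail)?; arith?)
  qed
qed

lemma finsum_form:
  assumes "finite A"
  shows "(\<Oplus>\<^bsub>Hq q\<^esub>i\<in>A. c i \<odot>\<^bsub>Hq q\<^esub> form (f i)) = form (\<Sum>i\<in>A. c i *\<^sub>C f i)"
proof -
  have "nf (sum g A) = (\<Sum>i\<in>A. nf (g i))" for g :: "_ \<Rightarrow> formspace"
    by (rule sum_map_additive[OF nf_add])
  then show ?thesis
    using finsum_cl[OF assms, of "\<lambda>i. nf (c i *\<^sub>C f i)"] by (simp add: form_smult) (simp add: form_def)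
qed

lemma Laplacian_eigenform:
  assumes "in_list i"
  shows "Laplacian q \<alpha> \<beta> (q\<^sup>2) (q powi (-4)) 1 (eigenform q i) =
      complex_of_real (eigenvalue q \<alpha> \<beta> i) \<odot>\<^bsub>Hq q\<^esub> eigenform q i"
proof -
  have homog: "eigen_row q i \<in> homog (form_grade (is_plus i))" by (rule eigen_row_homog[OF assms])
  show ?thesis
  proof (cases "is_plus i")
    case True
    then show ?thesis
      using homog by (simp add: eigenform_eq[OF assms] eigen_coords_def form_grade_def
        Laplacian_one_form[unfolded One_nat_def]
        eigen_row_plus[OF assms] eigenvalue_eq[OF assms] form_smult)
  next
    case False
    then show ?thesis
      using homog eigen_row_minus[OF assms False]
      by (simp add: eigenform_eq[OF assms] eigen_coords_def form_grade_def
        Laplacian_one_form[unfolded One_nat_def]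
         eigenvalue_eq[OF assms] form_smult del: scaleC_scaleC) simp
  qed
qed

lemma eigenform_basis: "is_basis (Hq q) (Omega1_S2 q) {i. in_list i} (eigenform q)"
  unfolding is_basis_def
proof (intro conjI ballI)
  have Omega: "Omega1_S2 q = form ` one_forms"
    unfolding Omega1_S2_eq one_forms_def by blast
  show "eigenform q ` {i. in_list i} \<subseteq> Omega1_S2 q"
    using eigen_coords_one_form by (auto simp: Omega eigenform_eq)
  fix X assume "X \<in> Omega1_S2 q"
  then obtain x where x: "X = form x" "x \<in> one_forms" unfolding Omega by blast
  \<comment> \<open>Coefficient functions of finite support are the same as elements of \<^typ>\<open>eig_index \<Rightarrow>\<^sub>0 complex\<close>.\<close>
  have expansion: "X = (\<Oplus>\<^bsub>Hq q\<^esub>i\<in>{i. c i \<noteq> 0}. c i \<odot>\<^bsub>Hq q\<^esub> eigenform q i) \<longleftrightarrow>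
      x = lin_ext (eigen_coords q) (Abs_poly_mapping c)"
    if c: "finite {i. c i \<noteq> 0}" "{i. c i \<noteq> 0} \<subseteq> {i. in_list i}" for c
  proof -
    interpret ring "Hq q" by (rule ring_Hq)
    have "(\<Oplus>\<^bsub>Hq q\<^esub>i\<in>{i. c i \<noteq> 0}. c i \<odot>\<^bsub>Hq q\<^esub> eigenform q i) =
        (\<Oplus>\<^bsub>Hq q\<^esub>i\<in>{i. c i \<noteq> 0}. c i \<odot>\<^bsub>Hq q\<^esub> form (eigen_coords q i))"
      using c(2) by (intro finsum_cong') (auto simp: eigenform_eq form_smult)
    also have "\<dots> = form (lin_ext (eigen_coords q) (Abs_poly_mapping c))"
      using c(1) by (simp add: finsum_form lin_ext_def keys.rep_eq)
    finally show ?thesis by (simp add: x(1))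
  qed
  obtain C where C: "Poly_Mapping.keys C \<subseteq> {i. in_list i}" "x = lin_ext (eigen_coords q) C"
    and unique: "\<And>D. Poly_Mapping.keys D \<subseteq> {i. in_list i} \<Longrightarrow> x = lin_ext (eigen_coords q) D \<Longrightarrow> D = C"
    using eigen_coords_basis[OF x(2), of q] by (elim ex1E) blast
  show "\<exists>!c. finite {i. c i \<noteq> 0} \<and> {i. c i \<noteq> 0} \<subseteq> {i. in_list i} \<and>
      X = (\<Oplus>\<^bsub>Hq q\<^esub>i\<in>{i. c i \<noteq> 0}. c i \<odot>\<^bsub>Hq q\<^esub> eigenform q i)"
  proof (rule ex1I[of _ "lookup C"])
    show "finite {i. lookup C i \<noteq> 0} \<and> {i. lookup C i \<noteq> 0} \<subseteq> {i. in_list i} \<and>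
      X = (\<Oplus>\<^bsub>Hq q\<^esub>i\<in>{i. lookup C i \<noteq> 0}. lookup C i \<odot>\<^bsub>Hq q\<^esub> eigenform q i)"
      using expansion[of "lookup C"] C by (simp add: keys.rep_eq lookup_inverse)
  next
    fix c
    assume c: "finite {i. c i \<noteq> 0} \<and> {i. c i \<noteq> 0} \<subseteq> {i. in_list i} \<and>
      X = (\<Oplus>\<^bsub>Hq q\<^esub>i\<in>{i. c i \<noteq> 0}. c i \<odot>\<^bsub>Hq q\<^esub> eigenform q i)"
    then have "Abs_poly_mapping c = C"
      using expansion[of c] by (intro unique) (auto simp: keys.rep_eq)
    then show "c = lookup C" using c by auto
  qed
qed

end

theorem theorem11p2:
  fixes q \<alpha> \<beta> :: real
  assumes "q \<noteq> 0"
  shows "(\<forall>i. in_list i \<longrightarrow>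
            eigenform q i \<in> Omega1_S2 q \<and>
            eigenform q i \<noteq> \<zero>\<^bsub>Hq q\<^esub> \<and>
            Laplacian q \<alpha> \<beta> (q\<^sup>2) (q powi (-4)) 1 (eigenform q i) =
              complex_of_real (eigenvalue q \<alpha> \<beta> i) \<odot>\<^bsub>Hq q\<^esub> eigenform q i)
         \<and> is_basis (Hq q) (Omega1_S2 q) {i. in_list i} (eigenform q)"
proof -
  interpret quantum_sphere q by standard (rule assms)
  have nonzero: "eigenform q i \<noteq> \<zero>\<^bsub>Hq q\<^esub>" if "in_list i" for i
  proof -
    have "eigen_coords q i \<noteq> 0"
      using coord_leading[OF that, of q] by (cases "leading i") (auto simp: zero_prod_def)
    then show ?thesis by (simp add: eigenform_eq[OF that] form_zero)
  qed
  have "eigenform q i \<in> Omega1_S2 q" if "in_list i" for i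
    using eigenform_basis that by (auto simp: is_basis_def)
  then show ?thesis
    using nonzero Laplacian_eigenform eigenform_basis by blast
qed

end
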